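(* Suppose that $\boldsymbol{w}=(w_1,\dots,w_p)'$ has i.i.d. positive entries with $\mathbb{E}w_1=\mu>0$, $\mathbb{E}(w_1-\mu)^2=\sigma^2$ and $\mathbb{E}|w_1-\mu|^4<\infty$, and let $\overline w=\frac1p\sum_{j=1}^pw_j$. Then, as $p\to\infty$, $$\nu_2:=\mathbb{E}\Bigl(\frac{w_1}{\overline w}-1\Bigr)^2=\mathbb{E}\Bigl(\frac{w_1}{\mu}-1\Bigr)^2+\frac1ph_1+o(p^{-1}),$$ $$\nu_{12}:=\mathbb{E}\Bigl(\frac{w_1}{\overline w}-1\Bigr)^2\Bigl(\frac{w_2}{\overline w}-1\Bigr)^2=\Bigl[\mathbb{E}\Bigl(\frac{w_1}{\mu}-1\Bigr)^2\Bigr]^2+\frac1ph_2+o(p^{-1}),$$ $$\nu_4:=\mathbb{E}\Bigl(\frac{w_1}{\overline w}-1\Bigr)^4=\mathbb{E}\Bigl(\frac{w_1}{\mu}-1\Bigr)^4+o(1),$$ where $$h_1=-2\frac{\mathbb{E}w_1^3}{\mu^3}+3\Bigl(\frac{\sigma^2}{\mu^2}\Bigr)^2+5\frac{\sigma^2}{\mu^2}+2,\qquad h_2=-8\frac{\sigma^2}{\mu^2}\frac{\mathbb{E}w_1^3}{\mu^3}+10\Bigl(\frac{\sigma^2}{\mu^2}\Bigr)^3+22\Bigl(\frac{\sigma^2}{\mu^2}\Bigr)^2+8\frac{\sigma^2}{\mu^2}.$$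
   Context: The common distribution of the $w_j$ does not depend on $p$. *)

theory Defs
  imports "HOL-Probability.Probability" "HOL-Library.Landau_Symbols"
begin

text \<open>
  The vector \<open>w\<close> of length \<open>p\<close> is a family of random variables on \<open>M\<close>, of which only the
  entries with index in \<open>{1..p}\<close> are relevant (so \<open>nu12\<close> is meaningful for \<open>p \<ge> 2\<close>).
  If these entries are positive almost surely, then \<open>0 < w j / w_mean p w \<le> p\<close> almost surely for
  \<open>j \<in> {1..p}\<close>, so the integrands below are bounded.
\<close>

definition w_mean :: "nat \<Rightarrow> (nat \<Rightarrow> 'a \<Rightarrow> real) \<Rightarrow> 'a \<Rightarrow> real" where
  "w_mean p w \<omega> = (\<Sum>j=1..p. w j \<omega>) / real p"

definition nu2 :: "'a measure \<Rightarrow> nat \<Rightarrow> (nat \<Rightarrow> 'a \<Rightarrow> real) \<Rightarrow> real" where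
  "nu2 M p w = (\<integral>\<omega>. (w 1 \<omega> / w_mean p w \<omega> - 1) ^ 2 \<partial>M)"

definition nu12 :: "'a measure \<Rightarrow> nat \<Rightarrow> (nat \<Rightarrow> 'a \<Rightarrow> real) \<Rightarrow> real" where
  "nu12 M p w =
     (\<integral>\<omega>. (w 1 \<omega> / w_mean p w \<omega> - 1) ^ 2 * (w 2 \<omega> / w_mean p w \<omega> - 1) ^ 2 \<partial>M)"

definition nu4 :: "'a measure \<Rightarrow> nat \<Rightarrow> (nat \<Rightarrow> 'a \<Rightarrow> real) \<Rightarrow> real" where
  "nu4 M p w = (\<integral>\<omega>. (w 1 \<omega> / w_mean p w \<omega> - 1) ^ 4 \<partial>M)"

text \<open>Here \<open>D\<close> is the common law of the entries, with mean \<open>\<mu>\<close> and variance \<open>\<sigma>\<^sup>2\<close>.\<close>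

definition h1 :: "real measure \<Rightarrow> real \<Rightarrow> real \<Rightarrow> real" where
  "h1 D \<mu> \<sigma> =
     - 2 * ((\<integral>x. x ^ 3 \<partial>D) / \<mu> ^ 3) + 3 * (\<sigma> ^ 2 / \<mu> ^ 2) ^ 2 + 5 * (\<sigma> ^ 2 / \<mu> ^ 2) + 2"

definition h2 :: "real measure \<Rightarrow> real \<Rightarrow> real \<Rightarrow> real" where
  "h2 D \<mu> \<sigma> =
     - 8 * (\<sigma> ^ 2 / \<mu> ^ 2) * ((\<integral>x. x ^ 3 \<partial>D) / \<mu> ^ 3) + 10 * (\<sigma> ^ 2 / \<mu> ^ 2) ^ 3
     + 22 * (\<sigma> ^ 2 / \<mu> ^ 2) ^ 2 + 8 * (\<sigma> ^ 2 / \<mu> ^ 2)"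

end

theory Submission
  imports Defs "HOL-Real_Asymp.Real_Asymp"
begin

text \<open>
  Put \<open>X j = w j / \<mu> - 1\<close> and let \<open>\<epsilon>\<close> be the mean of the \<open>X j\<close>, so that
  \<open>w j / w_mean p w - 1 = (X j - \<epsilon>) / (1 + \<epsilon>)\<close>. Where \<open>\<epsilon> \<ge> - 1 / 2\<close>, the second-order Taylor
  expansion in \<open>\<epsilon>\<close> has an error of order \<open>(1 + (X 1)\<^sup>2) (1 + (X 2)\<^sup>2) min \<epsilon>\<^sup>2 \<bar>\<epsilon>\<bar>\<^sup>3\<close>. Splitting
  \<open>p \<epsilon> = X 1 + X 2 + S\<close>, with \<open>S\<close> independent of \<open>X 1\<close> and \<open>X 2\<close>, the quadratic bound is used for the
  contribution of \<open>X 1\<close> and \<open>X 2\<close> and the cubic one for that of \<open>S\<close>, so that four moments suffice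
  and the expected error is \<open>O(p\<^sup>-\<^sup>3\<^sup>/\<^sup>2)\<close>. Where \<open>\<epsilon> < - 1 / 2\<close>, everything is
  bounded by a multiple of \<open>p\<^sup>4\<close>, because \<open>w j \<le> p * w_mean p w\<close> for positive entries, while that
  event has exponentially small probability by a one-sided Chernoff bound, which for positive
  variables needs only two moments.
\<close>

section \<open>Pointwise Taylor expansions\<close>

text \<open>The obstacle is the moment budget. Weighted by
  \<open>(1 + (X 1)\<^sup>2) * (1 + (X 2)\<^sup>2)\<close>, a purely cubic remainder would contain
  \<open>\<bar>X 1\<bar> ^ 5\<close>, while the part of a purely quadratic one that comes from
  \<open>S\<close> has expectation of order 1/p, the very order that is sought. In contrast, squares
  of \<open>X 1 / p\<close> and \<open>X 2 / p\<close> already have order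
  \<open>p\<^sup>-\<^sup>2\<close> and lead to fourth powers at most, and \<open>S\<close> is
  independent of the weight, so its fourth power costs nothing in \<open>X 1\<close> or
  \<open>X 2\<close>. For \<open>nu4\<close> the weight has degree four from the start and cannot
  afford another factor \<open>\<bar>X 1\<bar>\<close>. That factor is truncated at 1, and dominated
  convergence replaces a rate; hence only o(1). The spaces \<open>M p\<close> may be unrelated for
  different p. So no limit is taken on the sample: for each fixed p explicit inequalities are
  proved, with constants that depend only on moments of \<open>D\<close>, and limits concern numbers
  and integrals over \<open>D\<close>. The terms \<open>h1\<close> and \<open>h2\<close> are the 1/p
  coefficients of the expected Taylor polynomials, rewritten with the raw third moment.\<close>

text \<open>The cube is traded for even powers; \<open>\<delta> = 1 / sqrt p\<close> will balance the two terms.\<close>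

lemma min_square_cube_sum_le:
  fixes a b c \<epsilon> \<delta> :: real
  assumes "\<epsilon> = a + b + c" "\<delta> > 0"
  shows "min (\<epsilon>\<^sup>2) (\<bar>\<epsilon>\<bar> ^ 3) \<le> 8 * (a\<^sup>2 + b\<^sup>2 + (\<delta> * c\<^sup>2 + c ^ 4 / \<delta>))"
proof -
  have "0 \<le> (\<delta> - \<bar>c\<bar>)\<^sup>2 * c\<^sup>2 / \<delta>" using assms by simp
  also have "\<dots> = \<delta> * c\<^sup>2 + c ^ 4 / \<delta> - 2 * \<bar>c\<bar> ^ 3"
    using assms by (simp add: field_simps power2_eq_square power3_eq_cube power4_eq_xxxx abs_if)
  finally have c3: "2 * \<bar>c\<bar> ^ 3 \<le> \<delta> * c\<^sup>2 + c ^ 4 / \<delta>" by simp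
  have tri: "\<bar>\<epsilon>\<bar> \<le> \<bar>a + b\<bar> + \<bar>c\<bar>" using assms(1) abs_triangle_ineq[of "a + b" c] by simp
  have aux: "x \<le> 2 * y" if "x \<le> y + z" "z \<le> y" for x y z :: real using that by simp
  show ?thesis
  \<comment> \<open>The larger of \<open>\<bar>a + b\<bar>\<close> and \<open>\<bar>c\<bar>\<close>
    carries at least half of \<open>\<bar>\<epsilon>\<bar>\<close>. The square is used when it is
    the first, the cube when it is the second.\<close>
  proof (cases "\<bar>a + b\<bar> \<ge> \<bar>c\<bar>")
    case True
    then have "\<bar>\<epsilon>\<bar> \<le> 2 * \<bar>a + b\<bar>" using aux[OF tri] by blast
    then have "\<bar>\<epsilon>\<bar>\<^sup>2 \<le> (2 * \<bar>a + b\<bar>)\<^sup>2" by (rule power_mono) simp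
    moreover have "(2 * \<bar>a + b\<bar>)\<^sup>2 \<le> 8 * (a\<^sup>2 + b\<^sup>2)"
      using zero_le_power2[of "a - b"] by (simp add: power2_eq_square algebra_simps)
    moreover have "0 \<le> \<bar>c\<bar> ^ 3" by simp
    ultimately show ?thesis using c3 by (intro min.coboundedI1) (unfold power2_abs, argo)
  next
    case False
    then have "\<bar>\<epsilon>\<bar> \<le> 2 * \<bar>c\<bar>" using aux[OF tri[unfolded add.commute[of "\<bar>a + b\<bar>"]]] by (simp add: not_le)
    then have "\<bar>\<epsilon>\<bar> ^ 3 \<le> (2 * \<bar>c\<bar>) ^ 3" by (rule power_mono) simp
    then have "\<bar>\<epsilon>\<bar> ^ 3 \<le> 8 * \<bar>c\<bar> ^ 3" by (simp add: power_mult_distrib)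
    moreover have "0 \<le> a\<^sup>2" "0 \<le> b\<^sup>2" "0 \<le> \<bar>c\<bar> ^ 3" by simp_all
    ultimately show ?thesis using c3 by (intro min.coboundedI2) argo
  qed
qed

lemma one_plus_abs_square_le: "(1 + \<bar>u\<bar>)\<^sup>2 \<le> 2 * (1 + u\<^sup>2)" for u :: real
  using zero_le_power2[of "1 - \<bar>u\<bar>"] by (simp add: power2_eq_square algebra_simps)

text \<open>These quotients are the remainder terms of the Taylor expansions. For
  \<open>\<epsilon> \<ge> -1/2\<close> one has
  \<open>\<bar>\<epsilon>\<bar> / (1 + \<epsilon>) \<le> 1\<close>, so \<open>k - l\<close> powers
  of \<open>\<epsilon>\<close> cancel against the denominator and leave
  \<open>\<bar>\<epsilon>\<bar> ^ l\<close>, with \<open>l\<close> = 2 or 3. Each of the at most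
  four denominators left over costs a factor 2, whence 16.\<close>

lemma frac_power_le_min:
  fixes \<epsilon> :: real
  assumes "\<epsilon> \<ge> -1/2" "3 \<le> k" "k \<le> n + 2" "n \<le> 4"
  shows "\<bar>\<epsilon> ^ k / (1 + \<epsilon>) ^ n\<bar> \<le> 16 * min (\<epsilon>\<^sup>2) (\<bar>\<epsilon>\<bar> ^ 3)"
proof -
  have W: "1 + \<epsilon> \<ge> 1/2" using assms by simp
  have r: "\<bar>\<epsilon>\<bar> / (1 + \<epsilon>) \<le> 1" using W by (simp add: divide_le_eq)
  have i: "1 / (1 + \<epsilon>) \<le> 2" using W by (simp add: divide_le_eq)
  have eq: "\<bar>\<epsilon> ^ k / (1 + \<epsilon>) ^ n\<bar> = \<bar>\<epsilon>\<bar> ^ l * ((\<bar>\<epsilon>\<bar> / (1 + \<epsilon>)) ^ (k - l) * (1 / (1 + \<epsilon>)) ^ (n - (k - l)))"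
    if "l \<le> k" "k - l \<le> n" for l
  proof -
    have "\<bar>\<epsilon>\<bar> ^ k = \<bar>\<epsilon>\<bar> ^ l * \<bar>\<epsilon>\<bar> ^ (k - l)"
      using that by (simp flip: power_add)
    moreover have "(1 + \<epsilon>) ^ n = (1 + \<epsilon>) ^ (k - l) * (1 + \<epsilon>) ^ (n - (k - l))"
      using that by (simp flip: power_add)
    ultimately show ?thesis using W by (simp add: power_abs abs_mult power_divide)
  qed
  have bd: "\<bar>\<epsilon> ^ k / (1 + \<epsilon>) ^ n\<bar> \<le> 16 * \<bar>\<epsilon>\<bar> ^ l" if "l \<le> k" "k - l \<le> n" for l
  proof -
    have "(\<bar>\<epsilon>\<bar> / (1 + \<epsilon>)) ^ (k - l) \<le> 1"
      using r W by (intro power_le_one) auto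
    moreover have "(1 / (1 + \<epsilon>)) ^ (n - (k - l)) \<le> 16"
    proof -
      have "(1 / (1 + \<epsilon>)) ^ (n - (k - l)) \<le> 2 ^ (n - (k - l))"
        using i W by (intro power_mono) auto
      also have "\<dots> \<le> 2 ^ 4" using assms by (intro power_increasing) auto
      finally show ?thesis by simp
    qed
    ultimately have "(\<bar>\<epsilon>\<bar> / (1 + \<epsilon>)) ^ (k - l) * (1 / (1 + \<epsilon>)) ^ (n - (k - l)) \<le> 1 * 16"
      using W by (intro mult_mono) auto
    then have "\<bar>\<epsilon>\<bar> ^ l * ((\<bar>\<epsilon>\<bar> / (1 + \<epsilon>)) ^ (k - l) * (1 / (1 + \<epsilon>)) ^ (n - (k - l))) \<le> \<bar>\<epsilon>\<bar> ^ l * 16"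
      by (intro mult_left_mono) auto
    then show ?thesis using eq[OF that] by simp
  qed
  show ?thesis using bd[of 2] bd[of 3] assms by (auto simp: min_def)
qed

text \<open>
  Second-order Taylor polynomials in \<open>\<epsilon>\<close> of \<open>((u - \<epsilon>) / (1 + \<epsilon>))\<^sup>2\<close> and of
  \<open>((u - \<epsilon>) / (1 + \<epsilon>))\<^sup>2 * ((v - \<epsilon>) / (1 + \<epsilon>))\<^sup>2\<close>.
\<close>

definition taylor2 :: "real \<Rightarrow> real \<Rightarrow> real" where
  "taylor2 u \<epsilon> = u\<^sup>2 - 2 * u * \<epsilon> - 2 * u\<^sup>2 * \<epsilon> + \<epsilon>\<^sup>2 + 4 * u * \<epsilon>\<^sup>2 + 3 * u\<^sup>2 * \<epsilon>\<^sup>2"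

definition taylor12 :: "real \<Rightarrow> real \<Rightarrow> real \<Rightarrow> real" where
  "taylor12 u v \<epsilon> = u\<^sup>2 * v\<^sup>2 * (1 - 4 * \<epsilon> + 10 * \<epsilon>\<^sup>2) - 2 * (u\<^sup>2 * v + u * v\<^sup>2) * (\<epsilon> - 4 * \<epsilon>\<^sup>2)
     + (u\<^sup>2 + v\<^sup>2 + 4 * u * v) * \<epsilon>\<^sup>2"

lemma abs_sum3_le: "\<lbrakk>\<bar>a\<bar> \<le> A; \<bar>b\<bar> \<le> B; \<bar>c\<bar> \<le> C\<rbrakk> \<Longrightarrow> \<bar>a - b + c\<bar> \<le> A + B + C"
  for a b c :: real
  unfolding abs_le_iff by linarith

lemma abs_sum5_le:
  "\<lbrakk>\<bar>a\<bar> \<le> A; \<bar>b\<bar> \<le> B; \<bar>c\<bar> \<le> C; \<bar>d\<bar> \<le> D; \<bar>e\<bar> \<le> E\<rbrakk>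
    \<Longrightarrow> \<bar>a - b + c - d + e\<bar> \<le> A + B + C + D + E"
  for a b c d e :: real
  unfolding abs_le_iff by linarith

lemma abs_add4_le:
  fixes a b c d :: real
  assumes "\<bar>a\<bar> \<le> x" "\<bar>b\<bar> \<le> x" "\<bar>c\<bar> \<le> x" "\<bar>d\<bar> \<le> x"
  shows "\<bar>i * a + j * b + k * c + l * d\<bar> \<le> (\<bar>i\<bar> + \<bar>j\<bar> + \<bar>k\<bar> + \<bar>l\<bar>) * x"
proof -
  have "\<bar>i * a\<bar> \<le> \<bar>i\<bar> * x" "\<bar>j * b\<bar> \<le> \<bar>j\<bar> * x" "\<bar>k * c\<bar> \<le> \<bar>k\<bar> * x" "\<bar>l * d\<bar> \<le> \<bar>l\<bar> * x"
    using assms by (auto simp: abs_mult intro!: mult_left_mono)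
  then show ?thesis by (simp only: distrib_right) linarith
qed

text \<open>The numerator is expanded in powers of \<open>\<epsilon>\<close>; each
  \<open>e k\<close> with k at most 2 is a polynomial of degree 2 plus an exact combination of
  \<open>e 3\<close> and \<open>e 4\<close>. The absolute coefficients of the numerator add up to
  \<open>(1 + \<bar>u\<bar>)\<^sup>2 \<le> 2 * (1 + u\<^sup>2)\<close>, which turns 160 into
  320.\<close>

lemma square_quotient_taylor:
  fixes u \<epsilon> :: real
  assumes "\<epsilon> \<ge> -1/2"
  shows "\<bar>((u - \<epsilon>) / (1 + \<epsilon>))\<^sup>2 - taylor2 u \<epsilon>\<bar> \<le> 320 * ((1 + u\<^sup>2) * min (\<epsilon>\<^sup>2) (\<bar>\<epsilon>\<bar> ^ 3))"
proof -
  define \<phi> where "\<phi> = min (\<epsilon>\<^sup>2) (\<bar>\<epsilon>\<bar> ^ 3)"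
  define e where "e k = \<epsilon> ^ k / (1 + \<epsilon>)\<^sup>2" for k
  have e: "\<bar>e k\<bar> \<le> 16 * \<phi>" if "k = 3 \<or> k = 4" for k
    unfolding e_def \<phi>_def using assms that by (intro frac_power_le_min) auto
  have W: "1 + \<epsilon> \<noteq> 0" using assms by auto
  \<comment> \<open>The coefficients are what remains when the truncated series of
    \<open>\<epsilon> ^ k / (1 + \<epsilon>)\<^sup>2\<close> is multiplied by its denominator, for
    instance \<open>(1 - 2 * \<epsilon> + 3 * \<epsilon>\<^sup>2) * (1 + \<epsilon>)\<^sup>2 = 1 + 4
    * \<epsilon> ^ 3 + 3 * \<epsilon> ^ 4\<close>. The zero terms pad the sums to the shape of
    \<open>abs_add4_le\<close>; the largest bound is 7 * 16, below 160.\<close>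
  define r0 r1 r2 where "r0 = - 4 * e 3 + (-3) * e 4 + 0 * e 3 + 0 * e 3"
    and "r1 = 3 * e 3 + 2 * e 4 + 0 * e 3 + 0 * e 3"
    and "r2 = -2 * e 3 + (-1) * e 4 + 0 * e 3 + 0 * e 3"
  have \<phi>0: "\<phi> \<ge> 0" by (simp add: \<phi>_def)
  have r: "\<bar>r0\<bar> \<le> 160 * \<phi>" "\<bar>r1\<bar> \<le> 160 * \<phi>" "\<bar>r2\<bar> \<le> 160 * \<phi>"
    unfolding r0_def r1_def r2_def
    by (rule order_trans[OF abs_add4_le[of _ "16 * \<phi>"]]; use e \<phi>0 in simp)+
  have W2: "(1 + \<epsilon>)\<^sup>2 \<noteq> 0" using W by simp
  have q0: "e 0 = (1 - 2 * \<epsilon> + 3 * \<epsilon>\<^sup>2) + r0"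
    unfolding r0_def e_def using W2
    by (simp add: field_simps) (simp add: algebra_simps eval_nat_numeral)
  have q1: "e 1 = (\<epsilon> - 2 * \<epsilon>\<^sup>2) + r1"
    unfolding r1_def e_def using W2
    by (simp add: field_simps) (simp add: algebra_simps eval_nat_numeral)
  have q2: "e 2 = \<epsilon>\<^sup>2 + r2"
    unfolding r2_def e_def using W2
    by (simp add: field_simps) (simp add: algebra_simps eval_nat_numeral)
  have "((u - \<epsilon>) / (1 + \<epsilon>))\<^sup>2 = u\<^sup>2 * e 0 - 2 * u * e 1 + e 2"
  proof -
    have "(u - \<epsilon>)\<^sup>2 = u\<^sup>2 - 2 * u * \<epsilon> + \<epsilon>\<^sup>2" by (simp add: power2_diff)
    then show ?thesis
      unfolding e_def power_divide by (simp add: add_divide_distrib diff_divide_distrib)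
  qed
  then have "((u - \<epsilon>) / (1 + \<epsilon>))\<^sup>2 - taylor2 u \<epsilon> = u\<^sup>2 * r0 - 2 * u * r1 + r2"
    unfolding q0 q1 q2 taylor2_def by (simp add: algebra_simps power2_eq_square)
  also have "\<bar>\<dots>\<bar> \<le> u\<^sup>2 * (160 * \<phi>) + 2 * \<bar>u\<bar> * (160 * \<phi>) + 160 * \<phi>"
  proof -
    have *: "\<bar>c * x\<bar> \<le> d * (160 * \<phi>)" if "\<bar>c\<bar> \<le> d" "\<bar>x\<bar> \<le> 160 * \<phi>" for c d x
      unfolding abs_mult using that by (intro mult_mono) auto
    have "\<bar>u\<^sup>2 * r0\<bar> \<le> u\<^sup>2 * (160 * \<phi>)" using r by (intro *) auto
    moreover have "\<bar>2 * u * r1\<bar> \<le> 2 * \<bar>u\<bar> * (160 * \<phi>)" using r by (intro *) (auto simp: abs_mult)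
    ultimately show ?thesis using r(3) by (rule abs_sum3_le)
  qed
  also have "\<dots> = (1 + \<bar>u\<bar>)\<^sup>2 * (160 * \<phi>)" by (simp add: power2_eq_square algebra_simps)
  also have "\<dots> \<le> 2 * (1 + u\<^sup>2) * (160 * \<phi>)"
    using \<phi>0 by (intro mult_right_mono one_plus_abs_square_le) auto
  also have "\<dots> = 320 * ((1 + u\<^sup>2) * \<phi>)" by simp
  finally show ?thesis unfolding \<phi>_def .
qed

text \<open>The scheme of \<open>square_quotient_taylor\<close> with denominator
  \<open>(1 + \<epsilon>) ^ 4\<close>. The constant is 2000 times the factor 2 * 2 from bounding
  \<open>(1 + \<bar>u\<bar>)\<^sup>2 * (1 + \<bar>v\<bar>)\<^sup>2\<close>.\<close>

lemma square_product_quotient_taylor: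
  fixes u v \<epsilon> :: real
  assumes "\<epsilon> \<ge> -1/2"
  shows "\<bar>((u - \<epsilon>) / (1 + \<epsilon>))\<^sup>2 * ((v - \<epsilon>) / (1 + \<epsilon>))\<^sup>2 - taylor12 u v \<epsilon>\<bar>
    \<le> 8000 * ((1 + u\<^sup>2) * (1 + v\<^sup>2) * min (\<epsilon>\<^sup>2) (\<bar>\<epsilon>\<bar> ^ 3))"
proof -
  define \<phi> where "\<phi> = min (\<epsilon>\<^sup>2) (\<bar>\<epsilon>\<bar> ^ 3)"
  define e where "e k = \<epsilon> ^ k / (1 + \<epsilon>) ^ 4" for k
  have e: "\<bar>e k\<bar> \<le> 16 * \<phi>" if "k \<in> {3,4,5,6}" for k
    unfolding e_def \<phi>_def using assms that by (intro frac_power_le_min) auto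
  have W: "1 + \<epsilon> \<noteq> 0" using assms by auto
  define r0 r1 r2 where "r0 = - 20 * e 3 + (-45) * e 4 + (-36) * e 5 + (-10) * e 6"
    and "r1 = 10 * e 3 + 20 * e 4 + 15 * e 5 + 4 * e 6"
    and "r2 = -4 * e 3 + (-6) * e 4 + (-4) * e 5 + (-1) * e 6"
  have \<phi>0: "\<phi> \<ge> 0" by (simp add: \<phi>_def)
  have r: "\<bar>r0\<bar> \<le> 2000 * \<phi>" "\<bar>r1\<bar> \<le> 2000 * \<phi>" "\<bar>r2\<bar> \<le> 2000 * \<phi>"
    unfolding r0_def r1_def r2_def
    by (rule order_trans[OF abs_add4_le[of _ "16 * \<phi>"]]; use e \<phi>0 in simp)+
  \<comment> \<open>The cubic and quartic terms of the numerator have no Taylor part to split off;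
    they go into the remainder whole.\<close>
  have r34: "\<bar>e 3\<bar> \<le> 2000 * \<phi>" "\<bar>e 4\<bar> \<le> 2000 * \<phi>" using e[of 3] e[of 4] \<phi>0 by simp_all
  have W2: "(1 + \<epsilon>) ^ 4 \<noteq> 0" using W by simp
  have q0: "e 0 = (1 - 4 * \<epsilon> + 10 * \<epsilon>\<^sup>2) + r0"
    unfolding r0_def e_def using W2
    by (simp add: field_simps) (simp add: algebra_simps eval_nat_numeral)
  have q1: "e 1 = (\<epsilon> - 4 * \<epsilon>\<^sup>2) + r1"
    unfolding r1_def e_def using W2
    by (simp add: field_simps) (simp add: algebra_simps eval_nat_numeral)
  have q2: "e 2 = \<epsilon>\<^sup>2 + r2"
    unfolding r2_def e_def using W2
    by (simp add: field_simps) (simp add: algebra_simps eval_nat_numeral)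
  have "((u - \<epsilon>) / (1 + \<epsilon>))\<^sup>2 * ((v - \<epsilon>) / (1 + \<epsilon>))\<^sup>2 = ((u - \<epsilon>)\<^sup>2 * (v - \<epsilon>)\<^sup>2) / (1 + \<epsilon>) ^ 4"
    by (simp add: power_divide flip: power_add)
  also have "(u - \<epsilon>)\<^sup>2 * (v - \<epsilon>)\<^sup>2 = u\<^sup>2 * v\<^sup>2 - 2 * (u\<^sup>2 * v + u * v\<^sup>2) * \<epsilon>
     + (u\<^sup>2 + v\<^sup>2 + 4 * u * v) * \<epsilon>\<^sup>2 - 2 * (u + v) * \<epsilon> ^ 3 + \<epsilon> ^ 4"
    by (simp add: algebra_simps eval_nat_numeral)
  also have "\<dots> / (1 + \<epsilon>) ^ 4 = u\<^sup>2 * v\<^sup>2 * e 0 - 2 * (u\<^sup>2 * v + u * v\<^sup>2) * e 1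
     + (u\<^sup>2 + v\<^sup>2 + 4 * u * v) * e 2 - 2 * (u + v) * e 3 + e 4"
    unfolding e_def by (simp add: add_divide_distrib diff_divide_distrib)
  finally have "((u - \<epsilon>) / (1 + \<epsilon>))\<^sup>2 * ((v - \<epsilon>) / (1 + \<epsilon>))\<^sup>2 - taylor12 u v \<epsilon> = u\<^sup>2 * v\<^sup>2 * r0 - 2 * (u\<^sup>2 * v + u * v\<^sup>2) * r1
     + (u\<^sup>2 + v\<^sup>2 + 4 * u * v) * r2 - 2 * (u + v) * e 3 + e 4"
    unfolding q0 q1 q2 taylor12_def by (simp add: algebra_simps)
  then have "\<bar>((u - \<epsilon>) / (1 + \<epsilon>))\<^sup>2 * ((v - \<epsilon>) / (1 + \<epsilon>))\<^sup>2 - taylor12 u v \<epsilon>\<bar> \<le> u\<^sup>2 * v\<^sup>2 * (2000 * \<phi>) + 2 * (u\<^sup>2 * \<bar>v\<bar> + \<bar>u\<bar> * v\<^sup>2) * (2000 * \<phi>)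
     + (u\<^sup>2 + v\<^sup>2 + 4 * \<bar>u\<bar> * \<bar>v\<bar>) * (2000 * \<phi>) + 2 * (\<bar>u\<bar> + \<bar>v\<bar>) * (2000 * \<phi>) + 2000 * \<phi>"
  proof -
    have *: "\<bar>c * x\<bar> \<le> d * (2000 * \<phi>)" if "\<bar>c\<bar> \<le> d" "\<bar>x\<bar> \<le> 2000 * \<phi>" for c d x
      unfolding abs_mult using that by (intro mult_mono) auto
    have "\<bar>u\<^sup>2 * v\<^sup>2 * r0\<bar> \<le> u\<^sup>2 * v\<^sup>2 * (2000 * \<phi>)" using r by (intro *) auto
    moreover have "\<bar>2 * (u\<^sup>2 * v + u * v\<^sup>2) * r1\<bar> \<le> 2 * (u\<^sup>2 * \<bar>v\<bar> + \<bar>u\<bar> * v\<^sup>2) * (2000 * \<phi>)"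
      using r by (intro *) (auto simp: abs_mult intro!: order_trans[OF abs_triangle_ineq])
    moreover have "\<bar>(u\<^sup>2 + v\<^sup>2 + 4 * u * v) * r2\<bar> \<le> (u\<^sup>2 + v\<^sup>2 + 4 * \<bar>u\<bar> * \<bar>v\<bar>) * (2000 * \<phi>)"
      using r by (intro *) (auto simp: abs_mult intro!: order_trans[OF abs_triangle_ineq])
    moreover have "\<bar>2 * (u + v) * e 3\<bar> \<le> 2 * (\<bar>u\<bar> + \<bar>v\<bar>) * (2000 * \<phi>)"
      using r34 by (intro *) auto
    ultimately show ?thesis using r34(2) unfolding \<open>_ - taylor12 u v \<epsilon> = _\<close> by (rule abs_sum5_le)
  qed
  \<comment> \<open>With all signs made positive, the coefficients of
    \<open>(u - \<epsilon>)\<^sup>2 * (v - \<epsilon>)\<^sup>2\<close> as a polynomial in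
    \<open>\<epsilon>\<close> sum to its value at \<open>\<epsilon> = -1\<close> for
    \<open>\<bar>u\<bar>\<close> and \<open>\<bar>v\<bar>\<close>.\<close>
  also have "\<dots> = (1 + \<bar>u\<bar>)\<^sup>2 * (1 + \<bar>v\<bar>)\<^sup>2 * (2000 * \<phi>)"
  proof -
    have "x\<^sup>2 * y\<^sup>2 * c + 2 * (x\<^sup>2 * y + x * y\<^sup>2) * c + (x\<^sup>2 + y\<^sup>2 + 4 * x * y) * c + 2 * (x + y) * c + c
      = (1 + x)\<^sup>2 * (1 + y)\<^sup>2 * c" for x y c :: real
      by algebra
    from this[of "\<bar>u\<bar>" "\<bar>v\<bar>" "2000 * \<phi>"] show ?thesis by (simp only: power2_abs)
  qed
  also have "\<dots> \<le> (2 * (1 + u\<^sup>2)) * (2 * (1 + v\<^sup>2)) * (2000 * \<phi>)"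
    using \<phi>0 mult_mono[OF one_plus_abs_square_le[of u] one_plus_abs_square_le[of v]]
    by (intro mult_right_mono) simp_all
  also have "\<dots> = 8000 * ((1 + u\<^sup>2) * (1 + v\<^sup>2) * \<phi>)" by (simp add: algebra_simps)
  finally show ?thesis unfolding \<phi>_def .
qed

text \<open>With y for the quotient, \<open>y - u\<close> is \<open>1 + u\<close> times
  \<open>- \<epsilon> / (1 + \<epsilon>)\<close>, and \<open>y ^ 4 - u ^ 4\<close> factors through
  \<open>y - u\<close>. The cap at 1 keeps the right-hand side integrable under four moments. The
  constant is 80 * 8, from \<open>(1 + \<bar>u\<bar>) ^ 4 \<le> 8 * (1 + u ^ 4)\<close>.\<close>

lemma fourth_power_quotient_diff:
  fixes u \<epsilon> :: real
  assumes "\<epsilon> \<ge> -1/2"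
  shows "\<bar>((u - \<epsilon>) / (1 + \<epsilon>)) ^ 4 - u ^ 4\<bar> \<le> 640 * ((1 + u ^ 4) * min 1 \<bar>\<epsilon>\<bar>)"
proof -
  define y where "y = (u - \<epsilon>) / (1 + \<epsilon>)"
  define \<eta> where "\<eta> = min 1 \<bar>\<epsilon>\<bar>"
  define s where "s = 1 + \<bar>u\<bar>"
  have W: "1 + \<epsilon> \<ge> 1/2" using assms by simp
  have r: "\<bar>\<epsilon>\<bar> / (1 + \<epsilon>) \<le> 2 * \<eta>"
  proof (cases "\<bar>\<epsilon>\<bar> \<le> 1")
    case True
    have "\<bar>\<epsilon>\<bar> * 1 \<le> \<bar>\<epsilon>\<bar> * (2 * (1 + \<epsilon>))" using W by (intro mult_left_mono) auto
    then show ?thesis using True W by (simp add: \<eta>_def divide_le_eq mult_ac)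
  next
    case False
    then show ?thesis using W by (simp add: \<eta>_def divide_le_eq)
  qed
  have d: "y - u = - (\<epsilon> / (1 + \<epsilon>)) * (1 + u)"
    unfolding y_def using W by (simp add: field_simps)
  have yu: "\<bar>y - u\<bar> \<le> 2 * \<eta> * s"
  proof -
    have "\<bar>y - u\<bar> = \<bar>\<epsilon>\<bar> / (1 + \<epsilon>) * \<bar>1 + u\<bar>"
      using d W by (simp add: abs_mult)
    also have "\<dots> \<le> 2 * \<eta> * s"
      using r by (intro mult_mono) (auto simp: s_def \<eta>_def)
    finally show ?thesis .
  qed
  have "2 * \<eta> * s \<le> 2 * s" by (intro mult_right_mono) (simp_all add: \<eta>_def s_def)
  moreover have "\<bar>y\<bar> \<le> \<bar>y - u\<bar> + \<bar>u\<bar>" using abs_triangle_ineq[of "y - u" u] by simp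
  ultimately have y: "\<bar>y\<bar> \<le> 3 * s" using yu unfolding s_def by argo
  have p: "\<bar>y + u\<bar> \<le> 4 * s" using y abs_triangle_ineq[of y u] unfolding s_def by argo
  have q: "\<bar>y\<^sup>2 + u\<^sup>2\<bar> \<le> 10 * s\<^sup>2"
  proof -
    have "\<bar>y\<bar>\<^sup>2 \<le> (3 * s)\<^sup>2" by (rule power_mono[OF y]) simp
    moreover have "\<bar>u\<bar>\<^sup>2 \<le> s\<^sup>2" by (rule power_mono) (simp_all add: s_def)
    ultimately show ?thesis by (simp add: power_mult_distrib)
  qed
  have "\<bar>y ^ 4 - u ^ 4\<bar> = \<bar>y - u\<bar> * (\<bar>y + u\<bar> * \<bar>y\<^sup>2 + u\<^sup>2\<bar>)"
    unfolding abs_mult[symmetric] by (simp add: algebra_simps eval_nat_numeral)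
  also have "\<dots> \<le> (2 * \<eta> * s) * ((4 * s) * (10 * s\<^sup>2))"
    by (intro mult_mono yu p q) (simp_all add: s_def \<eta>_def)
  also have "\<dots> = 80 * \<eta> * (s\<^sup>2)\<^sup>2" by (simp add: power2_eq_square)
  also have "\<dots> \<le> 80 * \<eta> * (8 * (1 + u ^ 4))"
  proof (intro mult_left_mono)
    have "(s\<^sup>2)\<^sup>2 \<le> (2 * (1 + u\<^sup>2))\<^sup>2"
      unfolding s_def by (intro power_mono one_plus_abs_square_le) auto
    also have "\<dots> = 4 * (1 + u\<^sup>2)\<^sup>2" by (simp only: power_mult_distrib) simp
    also have "\<dots> \<le> 8 * (1 + u ^ 4)"
      using one_plus_abs_square_le[of "u\<^sup>2"] by simp
    finally show "(s\<^sup>2)\<^sup>2 \<le> 8 * (1 + u ^ 4)" .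
  qed (auto simp: \<eta>_def)
  finally show ?thesis by (simp add: y_def \<eta>_def algebra_simps)
qed

text \<open>Serves the rare event \<open>\<epsilon> < - 1 / 2\<close>, with p for \<open>P\<close>.
  The constant is the sum 1 + 2 + 2 + 1 + 4 + 3 of the absolute coefficients; the power
  \<open>P ^ 4\<close> is the common scale for all three expectations.\<close>

lemma abs_taylor2_le:
  assumes "\<bar>u\<bar> \<le> P" "\<bar>\<epsilon>\<bar> \<le> 1" "1 \<le> P"
  shows "\<bar>taylor2 u \<epsilon>\<bar> \<le> 13 * P ^ 4"
proof -
  have P: "1 \<le> P\<^sup>2" "P \<le> P\<^sup>2" "P\<^sup>2 \<le> P ^ 4"
    using assms power_increasing[of 0 2 P] power_increasing[of 1 2 P] power_increasing[of 2 4 P] by auto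
  have u2: "u\<^sup>2 \<le> P\<^sup>2" using power_mono[OF assms(1), of 2] by simp
  have e2: "\<epsilon>\<^sup>2 \<le> 1" using power_mono[OF assms(2), of 2] by simp
  have bd: "\<bar>x * y\<bar> \<le> c * 1" if "\<bar>x\<bar> \<le> c" "\<bar>y\<bar> \<le> 1" for x y c :: real
    unfolding abs_mult using that by (intro mult_mono) auto
  have 1: "\<bar>u * \<epsilon>\<bar> \<le> P * 1" "\<bar>u\<^sup>2 * \<epsilon>\<bar> \<le> P\<^sup>2 * 1" "\<bar>u * \<epsilon>\<^sup>2\<bar> \<le> P * 1" "\<bar>u\<^sup>2 * \<epsilon>\<^sup>2\<bar> \<le> P\<^sup>2 * 1"
    using assms u2 e2 by (intro bd; simp)+
  have taylor2: "taylor2 u \<epsilon> = u\<^sup>2 - 2 * (u * \<epsilon>) - 2 * (u\<^sup>2 * \<epsilon>) + \<epsilon>\<^sup>2 + 4 * (u * \<epsilon>\<^sup>2) + 3 * (u\<^sup>2 * \<epsilon>\<^sup>2)"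
    by (simp add: taylor2_def)
  show ?thesis
    using 1 u2 e2 P zero_le_power2[of u] zero_le_power2[of \<epsilon>] unfolding taylor2 abs_le_iff by linarith
qed

text \<open>The three groups of \<open>taylor12\<close> contribute 15, 2 * 2 * 5 and 6 to the
  constant.\<close>

lemma abs_taylor12_le:
  assumes "\<bar>u\<bar> \<le> P" "\<bar>v\<bar> \<le> P" "\<bar>\<epsilon>\<bar> \<le> 1" "1 \<le> P"
  shows "\<bar>taylor12 u v \<epsilon>\<bar> \<le> 41 * P ^ 4"
proof -
  have P: "P\<^sup>2 \<le> P ^ 4" "P ^ 3 \<le> P ^ 4" using assms(4) by (auto intro!: power_increasing)
  have u2: "u\<^sup>2 \<le> P\<^sup>2" using power_mono[OF assms(1), of 2] by simp
  have v2: "v\<^sup>2 \<le> P\<^sup>2" using power_mono[OF assms(2), of 2] by simp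
  have e2: "\<epsilon>\<^sup>2 \<le> 1" using power_mono[OF assms(3), of 2] by simp
  have bd: "\<bar>x * y\<bar> \<le> c * d" if "\<bar>x\<bar> \<le> c" "\<bar>y\<bar> \<le> d" for x y c d :: real
    unfolding abs_mult using that by (intro mult_mono) auto
  have a: "\<bar>1 - 4 * \<epsilon> + 10 * \<epsilon>\<^sup>2\<bar> \<le> 15" "\<bar>\<epsilon> - 4 * \<epsilon>\<^sup>2\<bar> \<le> 5"
    using assms(3) e2 zero_le_power2[of \<epsilon>] unfolding abs_le_iff by linarith+
  have "\<bar>u\<^sup>2 * v\<^sup>2\<bar> \<le> P\<^sup>2 * P\<^sup>2" using u2 v2 by (intro bd) auto
  then have "\<bar>u\<^sup>2 * v\<^sup>2\<bar> \<le> P ^ 4" by (simp flip: power_add)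
  then have 1: "\<bar>u\<^sup>2 * v\<^sup>2 * (1 - 4 * \<epsilon> + 10 * \<epsilon>\<^sup>2)\<bar> \<le> P ^ 4 * 15"
    using a by (intro bd)
  have "\<bar>u\<^sup>2 * v\<bar> \<le> P\<^sup>2 * P" "\<bar>u * v\<^sup>2\<bar> \<le> P * P\<^sup>2" using u2 v2 assms by (intro bd; simp)+
  then have "\<bar>u\<^sup>2 * v + u * v\<^sup>2\<bar> \<le> 2 * P ^ 3"
    using abs_triangle_ineq[of "u\<^sup>2 * v" "u * v\<^sup>2"] by (simp add: power3_eq_cube power2_eq_square mult.assoc)
  then have 2: "\<bar>(u\<^sup>2 * v + u * v\<^sup>2) * (\<epsilon> - 4 * \<epsilon>\<^sup>2)\<bar> \<le> 2 * P ^ 3 * 5"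
    using a by (intro bd)
  have "\<bar>u * v\<bar> \<le> P * P" using assms by (intro bd)
  then have "\<bar>u\<^sup>2 + v\<^sup>2 + 4 * (u * v)\<bar> \<le> 6 * P\<^sup>2"
    using u2 v2 zero_le_power2[of u] zero_le_power2[of v]
    unfolding power2_eq_square[of P] abs_le_iff by linarith
  then have 3: "\<bar>(u\<^sup>2 + v\<^sup>2 + 4 * (u * v)) * \<epsilon>\<^sup>2\<bar> \<le> 6 * P\<^sup>2 * 1"
    using e2 by (intro bd) auto
  have taylor12: "taylor12 u v \<epsilon> = u\<^sup>2 * v\<^sup>2 * (1 - 4 * \<epsilon> + 10 * \<epsilon>\<^sup>2) - 2 * ((u\<^sup>2 * v + u * v\<^sup>2) * (\<epsilon> - 4 * \<epsilon>\<^sup>2))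
     + (u\<^sup>2 + v\<^sup>2 + 4 * (u * v)) * \<epsilon>\<^sup>2"
    by (simp only: taylor12_def mult.assoc)
  show ?thesis
    using 1 2 3 P unfolding taylor12 abs_le_iff by linarith
qed

text \<open>The difference of the two sides vanishes at 0 and is monotone, by
  \<open>1 - y \<le> exp (- y)\<close>. This is how the Chernoff bound gets by with second moments:
  for a nonnegative variable the Laplace transform is controlled by two moments.\<close>

lemma exp_neg_le_quadratic: "exp (- y) \<le> 1 - y + y\<^sup>2 / 2" if "y \<ge> 0" for y :: real
proof -
  have *: "1 + y \<le> exp y" for y :: real by (rule exp_ge_add_one_self)
  have "((\<lambda>y. exp (- y) - (1 - y + y\<^sup>2 / 2)) has_real_derivative (- exp (- x) - (- 1 + x))) (at x)" for x :: real
    by (auto intro!: derivative_eq_intros)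
  moreover have "- exp (- x) - (- 1 + x) \<le> 0" for x :: real
    using *[of "- x"] by simp
  ultimately have "exp (- y) - (1 - y + y\<^sup>2 / 2) \<le> exp (- 0) - (1 - 0 + 0\<^sup>2 / 2)"
    by (intro DERIV_nonpos_imp_nonincreasing[OF that]) blast
  then show ?thesis by simp
qed

section \<open>Moments of a centered i.i.d. sample\<close>

text \<open>The sample size is fixed, and identical distribution enters only through common moments
  up to order 4, so one \<open>m\<close> can serve a different space for each p. Using
  \<open>has_bochner_integral\<close> lets integrability and value travel together. The bound
  \<open>X j > -1\<close> is positivity of the original entries.\<close>

locale iid_moments = prob_space +
  fixes X :: "nat \<Rightarrow> 'a \<Rightarrow> real" and p :: nat and m :: "nat \<Rightarrow> real"
  assumes indep: "indep_vars (\<lambda>_. borel) X {1..p}"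
    and moment: "\<And>j k. j \<in> {1..p} \<Longrightarrow> k \<le> 4 \<Longrightarrow> has_bochner_integral M (\<lambda>\<omega>. X j \<omega> ^ k) (m k)"
    and centered: "m 1 = 0"
    and p_ge_2: "2 \<le> p"
    and pos: "\<And>j. j \<in> {1..p} \<Longrightarrow> AE \<omega> in M. X j \<omega> > -1"
begin

lemma X_measurable [measurable]: "j \<in> {1..p} \<Longrightarrow> X j \<in> borel_measurable M"
  using indep by (auto simp: indep_vars_def)

lemma X12_measurable [measurable]: "X 1 \<in> borel_measurable M" "X (Suc 0) \<in> borel_measurable M"
  "X 2 \<in> borel_measurable M"
  using p_ge_2 X_measurable[of 1] X_measurable[of 2] by auto

lemma m0: "m 0 = 1"
proof -
  have "has_bochner_integral M (\<lambda>\<omega>. 1 :: real) (m 0)"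
    using moment[of 1 0] p_ge_2 by simp
  then show ?thesis
    by (simp add: has_bochner_integral_iff prob_space)
qed

lemma m2_nonneg: "0 \<le> m 2" and m4_nonneg: "0 \<le> m 4"
proof -
  have "m k \<ge> 0" if "k \<le> 4" "even k" for k
  proof -
    have "has_bochner_integral M (\<lambda>\<omega>. X 1 \<omega> ^ k) (m k)" using moment[of 1 k] that p_ge_2 by simp
    then have "m k = (\<integral>\<omega>. X 1 \<omega> ^ k \<partial>M)" by (simp add: has_bochner_integral_iff)
    also have "\<dots> \<ge> 0" using that by (intro integral_nonneg_AE) (simp add: zero_le_even_power)
    finally show ?thesis .
  qed
  from this[of 2] this[of 4] show "0 \<le> m 2" "0 \<le> m 4" by simp_all
qed

text \<open>Induction on the index set: the new variable is independent of the old sum, and in the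
  binomial expansion every term with a first moment vanishes. The third moment of the sum meets only
  the factor \<open>m 1 = 0\<close>, so its integrability suffices. In the fourth moment the cross
  term 6 n \<open>(m 2)\<^sup>2\<close> is the increment of 3 n (n - 1)
  \<open>(m 2)\<^sup>2\<close>.\<close>

lemma sum_moments:
  assumes "finite A" "A \<subseteq> {1..p}"
  shows "has_bochner_integral M (\<lambda>\<omega>. (\<Sum>j\<in>A. X j \<omega>) ^ 1) 0
    \<and> has_bochner_integral M (\<lambda>\<omega>. (\<Sum>j\<in>A. X j \<omega>) ^ 2) (real (card A) * m 2)
    \<and> integrable M (\<lambda>\<omega>. (\<Sum>j\<in>A. X j \<omega>) ^ 3)
    \<and> has_bochner_integral M (\<lambda>\<omega>. (\<Sum>j\<in>A. X j \<omega>) ^ 4)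
        (real (card A) * m 4 + 3 * real (card A) * (real (card A) - 1) * (m 2)\<^sup>2)"
  using assms
proof (induction A rule: finite_induct)
  case empty
  then show ?case by (simp add: has_bochner_integral_zero)
next
  case (insert a A)
  define S where "S \<omega> = (\<Sum>j\<in>A. X j \<omega>)" for \<omega>
  define n where "n = real (card A)"
  note IH = insert.IH[folded S_def n_def]
  have A: "A \<subseteq> {1..p}" "a \<in> {1..p}" using insert.prems by auto
  have ind: "indep_var borel (X a) borel S"
    unfolding S_def[abs_def] using insert indep_vars_subset[OF indep] by (intro indep_vars_sum) auto
  have S0: "has_bochner_integral M (\<lambda>\<omega>. S \<omega> ^ 0) 1"
    by (simp add: has_bochner_integral_iff prob_space)
  have prod: "has_bochner_integral M (\<lambda>\<omega>. X a \<omega> ^ i * S \<omega> ^ k) (m i * s)"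
    if "i \<le> 4" "has_bochner_integral M (\<lambda>\<omega>. S \<omega> ^ k) s" for i k s
  proof -
    have "indep_var borel ((\<lambda>x. x ^ i) \<circ> X a) borel ((\<lambda>x. x ^ k) \<circ> S)"
      by (rule indep_var_compose[OF ind]) auto
    then show ?thesis
      using indep_var_lebesgue_integral[of "\<lambda>\<omega>. X a \<omega> ^ i" "\<lambda>\<omega>. S \<omega> ^ k"]
        indep_var_integrable[of "\<lambda>\<omega>. X a \<omega> ^ i" "\<lambda>\<omega>. S \<omega> ^ k"] moment[OF A(2) that(1)] that(2)
      by (simp add: comp_def has_bochner_integral_iff)
  qed
  obtain s3 where S3: "has_bochner_integral M (\<lambda>\<omega>. S \<omega> ^ 3) s3"
    using IH A by (auto simp: integrable.simps)
  note S = S0 IH[OF A(1), THEN conjunct1] IH[OF A(1), THEN conjunct2, THEN conjunct1] S3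
    IH[OF A(1), THEN conjunct2, THEN conjunct2, THEN conjunct2]
  have mono: "has_bochner_integral M (\<lambda>\<omega>. c * (X a \<omega> ^ i * S \<omega> ^ k)) (c * (m i * s))"
    if "i \<le> 4" "has_bochner_integral M (\<lambda>\<omega>. S \<omega> ^ k) s" for i k s and c :: real
    by (intro has_bochner_integral_mult_right prod that)
  have eqS: "(\<Sum>j\<in>insert a A. X j \<omega>) = X a \<omega> + S \<omega>" for \<omega>
    using insert by (simp add: S_def)
  have card: "real (card (insert a A)) = n + 1" using insert by (simp add: n_def)
  have "has_bochner_integral M (\<lambda>\<omega>. 1 * (X a \<omega> ^ 1 * S \<omega> ^ 0) + 1 * (X a \<omega> ^ 0 * S \<omega> ^ 1))
      (1 * (m 1 * 1) + 1 * (m 0 * 0))"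
    by (intro has_bochner_integral_add mono S) auto
  then have 1: "has_bochner_integral M (\<lambda>\<omega>. (X a \<omega> + S \<omega>) ^ 1) 0"
    by (simp add: centered[simplified] m0)
  have "has_bochner_integral M (\<lambda>\<omega>. 1 * (X a \<omega> ^ 2 * S \<omega> ^ 0) + 2 * (X a \<omega> ^ 1 * S \<omega> ^ 1)
      + 1 * (X a \<omega> ^ 0 * S \<omega> ^ 2)) (1 * (m 2 * 1) + 2 * (m 1 * 0) + 1 * (m 0 * (n * m 2)))"
    by (intro has_bochner_integral_add mono S) auto
  then have 2: "has_bochner_integral M (\<lambda>\<omega>. (X a \<omega> + S \<omega>) ^ 2) ((n + 1) * m 2)"
    by (simp add: m0 power2_eq_square algebra_simps)
  have "has_bochner_integral M (\<lambda>\<omega>. 1 * (X a \<omega> ^ 3 * S \<omega> ^ 0) + 3 * (X a \<omega> ^ 2 * S \<omega> ^ 1)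
      + 3 * (X a \<omega> ^ 1 * S \<omega> ^ 2) + 1 * (X a \<omega> ^ 0 * S \<omega> ^ 3))
      (1 * (m 3 * 1) + 3 * (m 2 * 0) + 3 * (m 1 * (n * m 2)) + 1 * (m 0 * s3))"
    by (intro has_bochner_integral_add mono S) auto
  also have "(\<lambda>\<omega>. 1 * (X a \<omega> ^ 3 * S \<omega> ^ 0) + 3 * (X a \<omega> ^ 2 * S \<omega> ^ 1)
      + 3 * (X a \<omega> ^ 1 * S \<omega> ^ 2) + 1 * (X a \<omega> ^ 0 * S \<omega> ^ 3)) = (\<lambda>\<omega>. (X a \<omega> + S \<omega>) ^ 3)"
    by (simp add: fun_eq_iff eval_nat_numeral algebra_simps)
  finally have 3: "integrable M (\<lambda>\<omega>. (X a \<omega> + S \<omega>) ^ 3)"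
    by (simp add: has_bochner_integral_iff)
  have "has_bochner_integral M (\<lambda>\<omega>. 1 * (X a \<omega> ^ 4 * S \<omega> ^ 0) + 4 * (X a \<omega> ^ 3 * S \<omega> ^ 1)
      + 6 * (X a \<omega> ^ 2 * S \<omega> ^ 2) + 4 * (X a \<omega> ^ 1 * S \<omega> ^ 3) + 1 * (X a \<omega> ^ 0 * S \<omega> ^ 4))
      (1 * (m 4 * 1) + 4 * (m 3 * 0) + 6 * (m 2 * (n * m 2)) + 4 * (m 1 * s3)
        + 1 * (m 0 * (n * m 4 + 3 * n * (n - 1) * (m 2)\<^sup>2)))"
    by (intro has_bochner_integral_add mono S) auto
  also have "(\<lambda>\<omega>. 1 * (X a \<omega> ^ 4 * S \<omega> ^ 0) + 4 * (X a \<omega> ^ 3 * S \<omega> ^ 1)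
      + 6 * (X a \<omega> ^ 2 * S \<omega> ^ 2) + 4 * (X a \<omega> ^ 1 * S \<omega> ^ 3) + 1 * (X a \<omega> ^ 0 * S \<omega> ^ 4))
      = (\<lambda>\<omega>. (X a \<omega> + S \<omega>) ^ 4)"
    by (simp add: fun_eq_iff eval_nat_numeral algebra_simps)
  also have "1 * (m 4 * 1) + 4 * (m 3 * 0) + 6 * (m 2 * (n * m 2)) + 4 * (m 1 * s3)
        + 1 * (m 0 * (n * m 4 + 3 * n * (n - 1) * (m 2)\<^sup>2))
      = (n + 1) * m 4 + 3 * (n + 1) * ((n + 1) - 1) * (m 2)\<^sup>2"
    unfolding m0 centered by (simp add: power2_eq_square algebra_simps)
  finally have 4: "has_bochner_integral M (\<lambda>\<omega>. (X a \<omega> + S \<omega>) ^ 4)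
      ((n + 1) * m 4 + 3 * (n + 1) * ((n + 1) - 1) * (m 2)\<^sup>2)" .
  from 1 2 3 4 show ?case unfolding eqS card by blast
qed

section \<open>The mean split at the first two entries; mixed moments\<close>

definition S :: "'a \<Rightarrow> real" where "S \<omega> = (\<Sum>j\<in>{3..p}. X j \<omega>)"

definition \<epsilon> :: "'a \<Rightarrow> real" where "\<epsilon> \<omega> = (X 1 \<omega> + X 2 \<omega> + S \<omega>) / real p"

lemma S_measurable [measurable]: "S \<in> borel_measurable M"
  unfolding S_def[abs_def] by (intro borel_measurable_sum X_measurable) auto

lemma \<epsilon>_measurable [measurable]: "\<epsilon> \<in> borel_measurable M"
  unfolding \<epsilon>_def[abs_def] by measurable

lemma \<epsilon>_eq_mean: "\<epsilon> \<omega> = (\<Sum>j=1..p. X j \<omega>) / real p"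
proof -
  have "{1..p} = insert 1 (insert 2 {3..p})" using p_ge_2 by auto
  then show ?thesis by (simp add: \<epsilon>_def S_def)
qed

lemma S_moments:
  shows S_moment1: "has_bochner_integral M (\<lambda>\<omega>. S \<omega> ^ 1) 0"
    and S_moment2: "has_bochner_integral M (\<lambda>\<omega>. S \<omega> ^ 2) ((real p - 2) * m 2)"
    and S_moment4: "has_bochner_integral M (\<lambda>\<omega>. S \<omega> ^ 4)
          ((real p - 2) * m 4 + 3 * (real p - 2) * (real p - 3) * (m 2)\<^sup>2)"
  using sum_moments[of "{3..p}"] p_ge_2 by (simp_all add: of_nat_diff flip: S_def)

lemma S_moment0: "has_bochner_integral M (\<lambda>\<omega>. S \<omega> ^ 0) 1"
  by (simp add: has_bochner_integral_iff prob_space)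

text \<open>The index blocks {1}, {2} and {3..p} are disjoint, so functions of the respective
  subvectors are independent and the expectation factorizes.\<close>

lemma integral_X1_X2_S:
  fixes f g h :: "real \<Rightarrow> real"
  assumes [measurable]: "f \<in> borel_measurable borel" "g \<in> borel_measurable borel" "h \<in> borel_measurable borel"
    and "has_bochner_integral M (\<lambda>\<omega>. f (X 1 \<omega>)) a" "has_bochner_integral M (\<lambda>\<omega>. g (X 2 \<omega>)) b"
    "has_bochner_integral M (\<lambda>\<omega>. h (S \<omega>)) c"
  shows "has_bochner_integral M (\<lambda>\<omega>. f (X 1 \<omega>) * g (X 2 \<omega>) * h (S \<omega>)) (a * b * c)"
proof -
  define K where "K = (\<lambda>i::nat. if i = 1 then {1} else if i = 2 then {2} else {3..p})"
  \<comment> \<open>Three unlike functions are packed into one family indexed by the blocks, the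
    form that \<open>indep_vars_compose2\<close> expects.\<close>
  define Y where "Y = (\<lambda>(n :: nat) F. if n = 1 then f (F 1) else if n = 2 then g (F 2)
    else h (\<Sum>l\<in>{3..p}. F l :: real))"
  define Z where "Z = (\<lambda>n \<omega>. Y n (restrict (\<lambda>i. X i \<omega>) (K n)))"
  have "indep_vars (\<lambda>j. PiM (K j) (\<lambda>_. borel)) (\<lambda>j \<omega>. restrict (\<lambda>i. X i \<omega>) (K j)) {1, 2, 3}"
    using p_ge_2 by (intro indep_vars_restrict[OF indep]) (auto simp: K_def disjoint_family_on_def)
  moreover have "Y n \<in> measurable (PiM (K n) (\<lambda>_. borel)) borel" if n: "n \<in> {1, 2, 3}" for n
  proof -
    consider "n = 1" | "n = 2" | "n = 3" using n by auto
    then show ?thesis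
    proof cases
      case 1
      have "(\<lambda>F. f (F 1)) \<in> borel_measurable (PiM {1 :: nat} (\<lambda>_. borel))" by measurable
      then show ?thesis using 1 by (simp add: Y_def K_def)
    next
      case 2
      have "(\<lambda>F. g (F 2)) \<in> borel_measurable (PiM {2 :: nat} (\<lambda>_. borel))" by measurable
      then show ?thesis using 2 by (simp add: Y_def K_def)
    next
      case 3
      have "(\<lambda>F. h (\<Sum>l\<in>{3..p}. F l)) \<in> borel_measurable (PiM {3..p} (\<lambda>_. borel))" by measurable
      then show ?thesis using 3 by (simp add: Y_def K_def)
    qed
  qed
  ultimately have ind: "indep_vars (\<lambda>_. borel) Z {1, 2, 3}"
    unfolding Z_def by (rule indep_vars_compose2)
  have Z: "Z 1 = (\<lambda>\<omega>. f (X 1 \<omega>))" "Z 2 = (\<lambda>\<omega>. g (X 2 \<omega>))" "Z 3 = (\<lambda>\<omega>. h (S \<omega>))"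
    by (simp_all add: Z_def Y_def K_def S_def fun_eq_iff)
  have int: "integrable M (Z i)" if "i \<in> {1, 2, 3}" for i
    using that assms by (auto simp: Z[simplified] has_bochner_integral_iff)
  show ?thesis
    using indep_vars_lebesgue_integral[OF _ ind int] indep_vars_integrable[OF _ ind int] assms
    by (simp add: Z[simplified] has_bochner_integral_iff mult.assoc)
qed

lemma monomial_moment:
  assumes "i \<le> 4" "j \<le> 4" "has_bochner_integral M (\<lambda>\<omega>. S \<omega> ^ k) s"
  shows "has_bochner_integral M (\<lambda>\<omega>. X 1 \<omega> ^ i * X 2 \<omega> ^ j * S \<omega> ^ k) (m i * m j * s)"
  using assms p_ge_2 by (intro integral_X1_X2_S moment) auto

lemma monomial_moment_\<epsilon>0:
  assumes "i \<le> 4" "j \<le> 4"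
  shows "has_bochner_integral M (\<lambda>\<omega>. X 1 \<omega> ^ i * X 2 \<omega> ^ j * \<epsilon> \<omega> ^ 0) (m i * m j)"
  using monomial_moment[OF assms S_moment0] by simp

text \<open>The term with \<open>S\<close> drops out because \<open>S\<close> is centered and
  independent of the rest; \<open>X 1\<close> and \<open>X 2\<close> each raise their own exponent
  by one, hence the limit 3 on the exponents.\<close>

lemma monomial_moment_\<epsilon>1:
  assumes "i \<le> 3" "j \<le> 3"
  shows "has_bochner_integral M (\<lambda>\<omega>. X 1 \<omega> ^ i * X 2 \<omega> ^ j * \<epsilon> \<omega> ^ 1)
    ((m (i + 1) * m j + m i * m (j + 1)) / real p)"
proof -
  have "has_bochner_integral M (\<lambda>\<omega>. (1 / real p) * (X 1 \<omega> ^ (i + 1) * X 2 \<omega> ^ j * S \<omega> ^ 0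
        + X 1 \<omega> ^ i * X 2 \<omega> ^ (j + 1) * S \<omega> ^ 0 + X 1 \<omega> ^ i * X 2 \<omega> ^ j * S \<omega> ^ 1))
      ((1 / real p) * (m (i + 1) * m j * 1 + m i * m (j + 1) * 1 + m i * m j * 0))"
    using assms
    by (intro has_bochner_integral_mult_right has_bochner_integral_add monomial_moment
        S_moment0 S_moment1) auto
  then show ?thesis by (simp add: \<epsilon>_def algebra_simps add_divide_distrib)
qed

text \<open>Among the terms of the expanded square only \<open>S\<^sup>2\<close> is of order p. Its
  moment \<open>(p - 2) * m 2\<close> gives the 1/p term, and the -2 joins the
  \<open>p\<^sup>-\<^sup>2\<close> coefficient.\<close>

lemma monomial_moment_\<epsilon>2:
  assumes "i \<le> 2" "j \<le> 2"
  shows "has_bochner_integral M (\<lambda>\<omega>. X 1 \<omega> ^ i * X 2 \<omega> ^ j * \<epsilon> \<omega> ^ 2)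
    (m 2 * m i * m j / real p
     + (m (i + 2) * m j + 2 * (m (i + 1) * m (j + 1)) + m i * m (j + 2) - 2 * m 2 * m i * m j) / (real p)\<^sup>2)"
proof -
  have "has_bochner_integral M (\<lambda>\<omega>. (1 / (real p)\<^sup>2) * (
        X 1 \<omega> ^ (i + 2) * X 2 \<omega> ^ j * S \<omega> ^ 0
        + 2 * (X 1 \<omega> ^ (i + 1) * X 2 \<omega> ^ (j + 1) * S \<omega> ^ 0)
        + X 1 \<omega> ^ i * X 2 \<omega> ^ (j + 2) * S \<omega> ^ 0
        + 2 * (X 1 \<omega> ^ (i + 1) * X 2 \<omega> ^ j * S \<omega> ^ 1)
        + 2 * (X 1 \<omega> ^ i * X 2 \<omega> ^ (j + 1) * S \<omega> ^ 1)
        + X 1 \<omega> ^ i * X 2 \<omega> ^ j * S \<omega> ^ 2))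
      ((1 / (real p)\<^sup>2) * (m (i + 2) * m j * 1 + 2 * (m (i + 1) * m (j + 1) * 1)
        + m i * m (j + 2) * 1 + 2 * (m (i + 1) * m j * 0) + 2 * (m i * m (j + 1) * 0)
        + m i * m j * ((real p - 2) * m 2)))"
    using assms
    by (intro has_bochner_integral_mult_right has_bochner_integral_add monomial_moment
        S_moment0 S_moment1 S_moment2) auto
  also have "(\<lambda>\<omega>. (1 / (real p)\<^sup>2) * (
        X 1 \<omega> ^ (i + 2) * X 2 \<omega> ^ j * S \<omega> ^ 0
        + 2 * (X 1 \<omega> ^ (i + 1) * X 2 \<omega> ^ (j + 1) * S \<omega> ^ 0)
        + X 1 \<omega> ^ i * X 2 \<omega> ^ (j + 2) * S \<omega> ^ 0
        + 2 * (X 1 \<omega> ^ (i + 1) * X 2 \<omega> ^ j * S \<omega> ^ 1)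
        + 2 * (X 1 \<omega> ^ i * X 2 \<omega> ^ (j + 1) * S \<omega> ^ 1)
        + X 1 \<omega> ^ i * X 2 \<omega> ^ j * S \<omega> ^ 2)) = (\<lambda>\<omega>. X 1 \<omega> ^ i * X 2 \<omega> ^ j * \<epsilon> \<omega> ^ 2)"
  proof
    fix \<omega>
    show "(1 / (real p)\<^sup>2) * (
        X 1 \<omega> ^ (i + 2) * X 2 \<omega> ^ j * S \<omega> ^ 0
        + 2 * (X 1 \<omega> ^ (i + 1) * X 2 \<omega> ^ (j + 1) * S \<omega> ^ 0)
        + X 1 \<omega> ^ i * X 2 \<omega> ^ (j + 2) * S \<omega> ^ 0
        + 2 * (X 1 \<omega> ^ (i + 1) * X 2 \<omega> ^ j * S \<omega> ^ 1)
        + 2 * (X 1 \<omega> ^ i * X 2 \<omega> ^ (j + 1) * S \<omega> ^ 1)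
        + X 1 \<omega> ^ i * X 2 \<omega> ^ j * S \<omega> ^ 2) = X 1 \<omega> ^ i * X 2 \<omega> ^ j * \<epsilon> \<omega> ^ 2"
      unfolding \<epsilon>_def power_add power_divide by (simp add: power2_eq_square algebra_simps add_divide_distrib)
  qed
  also have "(1 / (real p)\<^sup>2) * (m (i + 2) * m j * 1 + 2 * (m (i + 1) * m (j + 1) * 1)
        + m i * m (j + 2) * 1 + 2 * (m (i + 1) * m j * 0) + 2 * (m i * m (j + 1) * 0)
        + m i * m j * ((real p - 2) * m 2)) = m 2 * m i * m j / real p
     + (m (i + 2) * m j + 2 * (m (i + 1) * m (j + 1)) + m i * m (j + 2) - 2 * m 2 * m i * m j) / (real p)\<^sup>2"
    using p_ge_2 by (simp add: field_simps power2_eq_square)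
  finally show ?thesis .
qed

section \<open>Lower deviations and the Taylor remainder\<close>

text \<open>The minimum over t of \<open>exp (- t / 2 + t\<^sup>2 * (1 + m 2) / 2)\<close>, a number
  below 1. Here \<open>1 + m 2\<close> is the second moment of \<open>1 + X j\<close>.\<close>

definition chernoff_rate :: real where
  "chernoff_rate = exp (- 1 / (8 * (1 + m 2)))"

text \<open>On this event the mean of the positive variables \<open>1 + X j\<close> is below 1/2,
  while their expectation is 1. Exponential Markov with a negative exponent applies, and
  \<open>exp_neg_le_quadratic\<close> bounds each factor.\<close>

lemma prob_\<epsilon>_small: "prob {\<omega> \<in> space M. \<epsilon> \<omega> < - 1 / 2} \<le> chernoff_rate ^ p"
proof -
  define q where "q = 1 + m 2"
  have q: "q \<ge> 1" using m2_nonneg by (simp add: q_def)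
  \<comment> \<open>The minimizer of the exponent \<open>- t / 2 + t\<^sup>2 * q / 2\<close>, with
    value \<open>- 1 / (8 * q)\<close>.\<close>
  define t where "t = 1 / (2 * q)"
  have t: "t > 0" using q by (simp add: t_def)
  define Y where "Y j \<omega> = exp (- (t * (1 / 2 + X j \<omega>)))" for j \<omega>
  have bound: "AE \<omega> in M. exp (- (t * (1 + X j \<omega>))) \<le> 1 - t * (1 + X j \<omega>) + (t * (1 + X j \<omega>))\<^sup>2 / 2"
    if "j \<in> {1..p}" for j
    using pos[OF that]
  proof eventually_elim
    case (elim \<omega>)
    then show ?case using t by (intro exp_neg_le_quadratic) simp
  qed
  have quad: "has_bochner_integral M
      (\<lambda>\<omega>. 1 - t * (1 + X j \<omega>) + (t * (1 + X j \<omega>))\<^sup>2 / 2) (1 - t + t\<^sup>2 * q / 2)"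
    if "j \<in> {1..p}" for j
  proof -
    have "has_bochner_integral M (\<lambda>\<omega>. (1 - t + t\<^sup>2 / 2) * X j \<omega> ^ 0 + (t\<^sup>2 - t) * X j \<omega> ^ 1
        + (t\<^sup>2 / 2) * X j \<omega> ^ 2)
      ((1 - t + t\<^sup>2 / 2) * m 0 + (t\<^sup>2 - t) * m 1 + (t\<^sup>2 / 2) * m 2)"
      using that by (intro has_bochner_integral_add has_bochner_integral_mult_right moment) auto
    also have "(1 - t + t\<^sup>2 / 2) * m 0 + (t\<^sup>2 - t) * m 1 + (t\<^sup>2 / 2) * m 2 = 1 - t + t\<^sup>2 * q / 2"
      unfolding m0 centered q_def by (simp add: field_simps)
    also have "(\<lambda>\<omega>. (1 - t + t\<^sup>2 / 2) * X j \<omega> ^ 0 + (t\<^sup>2 - t) * X j \<omega> ^ 1 + (t\<^sup>2 / 2) * X j \<omega> ^ 2)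
      = (\<lambda>\<omega>. 1 - t * (1 + X j \<omega>) + (t * (1 + X j \<omega>))\<^sup>2 / 2)"
      by (simp add: fun_eq_iff power2_eq_square field_simps)
    finally show ?thesis .
  qed
  have meas [measurable]: "Y j \<in> borel_measurable M" if "j \<in> {1..p}" for j
    using X_measurable[OF that] unfolding Y_def[abs_def] by measurable
  have intY: "integrable M (Y j)" and EY: "expectation (Y j) \<le> chernoff_rate" if j: "j \<in> {1..p}" for j
  proof -
    have [measurable]: "X j \<in> borel_measurable M" by (rule X_measurable[OF j])
    have Y: "Y j = (\<lambda>\<omega>. exp (t / 2) * exp (- (t * (1 + X j \<omega>))))"
      by (simp add: Y_def fun_eq_iff algebra_simps flip: exp_add)
    \<comment> \<open>Positivity makes the exponential at most 1, so no exponential moment is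
      required.\<close>
    have int: "integrable M (\<lambda>\<omega>. exp (- (t * (1 + X j \<omega>))))"
    proof (rule Bochner_Integration.integrable_bound)
      show "integrable M (\<lambda>\<omega>. 1 :: real)" by simp
      show "AE \<omega> in M. norm (exp (- (t * (1 + X j \<omega>)))) \<le> norm (1 :: real)"
        using pos[OF j] by eventually_elim (use t in simp)
    qed measurable
    then show "integrable M (Y j)" unfolding Y by simp
    have "expectation (\<lambda>\<omega>. exp (- (t * (1 + X j \<omega>)))) \<le> 1 - t + t\<^sup>2 * q / 2"
      using integral_mono_AE[OF int _ bound[OF j]] quad[OF j] by (simp add: has_bochner_integral_iff)
    also have "\<dots> \<le> exp (- t + t\<^sup>2 * q / 2)"
      using exp_ge_add_one_self[of "- t + t\<^sup>2 * q / 2"] by (simp add: algebra_simps)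
    finally have "expectation (Y j) \<le> exp (t / 2) * exp (- t + t\<^sup>2 * q / 2)"
      unfolding Y by simp
    also have "\<dots> = exp (- t / 2 + t\<^sup>2 * q / 2)" by (simp flip: exp_add)
    also have "- t / 2 + t\<^sup>2 * q / 2 = - 1 / (8 * q)"
      using q by (simp add: t_def field_simps power2_eq_square)
    finally show "expectation (Y j) \<le> chernoff_rate" by (simp add: chernoff_rate_def q_def)
  qed
  have indY: "indep_vars (\<lambda>_. borel) Y {1..p}"
    unfolding Y_def[abs_def] by (rule indep_vars_compose2[OF indep]) auto
  have "prob {\<omega> \<in> space M. \<epsilon> \<omega> < - 1 / 2}
      = expectation (indicator {\<omega> \<in> space M. \<epsilon> \<omega> < - 1 / 2})"
    by simp
  \<comment> \<open>The product is \<open>exp (- t * p * (1 / 2 + \<epsilon>))\<close>: positive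
    everywhere and at least 1 on the event.\<close>
  also have "\<dots> \<le> expectation (\<lambda>\<omega>. \<Prod>j\<in>{1..p}. Y j \<omega>)"
  proof (rule integral_mono)
    show "integrable M (\<lambda>\<omega>. \<Prod>j\<in>{1..p}. Y j \<omega>)"
      using indY intY by (intro indep_vars_integrable) auto
    fix \<omega>
    have "(\<Prod>j\<in>{1..p}. Y j \<omega>) = exp (- (t * (\<Sum>j=1..p. 1 / 2 + X j \<omega>)))"
      by (simp add: Y_def exp_sum sum_distrib_left flip: sum_negf)
    also have "(\<Sum>j=1..p. 1 / 2 + X j \<omega>) = real p * (1 / 2 + \<epsilon> \<omega>)"
      using p_ge_2 by (simp add: \<epsilon>_eq_mean sum.distrib algebra_simps)
    finally have eq: "(\<Prod>j\<in>{1..p}. Y j \<omega>) = exp (- (t * (real p * (1 / 2 + \<epsilon> \<omega>))))" .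
    show "indicator {\<omega> \<in> space M. \<epsilon> \<omega> < - 1 / 2} \<omega> \<le> (\<Prod>j\<in>{1..p}. Y j \<omega>)"
    proof (cases "\<epsilon> \<omega> < - 1 / 2")
      case True
      then have "t * (real p * (1 / 2 + \<epsilon> \<omega>)) \<le> 0"
        using t by (intro mult_nonneg_nonpos) auto
      then show ?thesis unfolding eq by (simp add: indicator_def)
    qed (simp add: Y_def prod_nonneg)
    show "integrable M (indicat_real {\<omega> \<in> space M. \<epsilon> \<omega> < - 1 / 2})"
      by (rule integrable_real_indicator) (simp_all add: less_top[symmetric])
  qed
  also have "\<dots> = (\<Prod>j\<in>{1..p}. expectation (Y j))"
    using indY intY by (intro indep_vars_lebesgue_integral) auto
  also have "\<dots> \<le> (\<Prod>j\<in>{1..p}. chernoff_rate)"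
    by (intro prod_mono conjI EY integral_nonneg_AE) (auto simp: Y_def)
  finally show ?thesis by simp
qed

text \<open>The common frame of the three estimates: \<open>T\<close> is the approximation with
  known mean, \<open>B\<close> dominates the error on the good event, and the constant
  \<open>C\<close> does so on the rare one. Nonnegativity of \<open>B\<close> makes
  \<open>B + C * indicator\<close> a bound everywhere; integrability of \<open>Z\<close> follows by
  writing it as \<open>(Z - T) + T\<close>.\<close>

lemma integral_approx:
  assumes [measurable]: "Z \<in> borel_measurable M"
    and T: "has_bochner_integral M T \<tau>" and B: "has_bochner_integral M B \<beta>"
    and large: "AE \<omega> in M. \<epsilon> \<omega> \<ge> - 1 / 2 \<longrightarrow> \<bar>Z \<omega> - T \<omega>\<bar> \<le> B \<omega>"
    and small: "AE \<omega> in M. \<epsilon> \<omega> < - 1 / 2 \<longrightarrow> \<bar>Z \<omega> - T \<omega>\<bar> \<le> C"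
    and nonneg: "\<And>\<omega>. B \<omega> \<ge> 0" "C \<ge> 0"
  shows "\<bar>expectation Z - \<tau>\<bar> \<le> \<beta> + C * chernoff_rate ^ p"
proof -
  define A where "A = {\<omega> \<in> space M. \<epsilon> \<omega> < - 1 / 2}"
  have A [measurable]: "A \<in> sets M" unfolding A_def by measurable
  have [measurable]: "T \<in> borel_measurable M" using T by (auto simp: has_bochner_integral_iff)
  have iA: "integrable M (indicat_real A)" by (simp add: integrable_real_indicator less_top[symmetric])
  then have dom: "integrable M (\<lambda>\<omega>. B \<omega> + C * indicator A \<omega>)"
    using B by (auto simp: has_bochner_integral_iff)
  have bound: "AE \<omega> in M. \<bar>Z \<omega> - T \<omega>\<bar> \<le> B \<omega> + C * indicator A \<omega>"
    using large small AE_space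
  proof eventually_elim
    case (elim \<omega>)
    then show ?case using nonneg(1)[of \<omega>] nonneg(2)
      by (cases "\<epsilon> \<omega> < - 1 / 2") (auto simp: A_def indicator_def)
  qed
  have diff: "integrable M (\<lambda>\<omega>. Z \<omega> - T \<omega>)"
    by (rule Bochner_Integration.integrable_bound[OF dom]) (use bound in auto)
  then have "integrable M (\<lambda>\<omega>. (Z \<omega> - T \<omega>) + T \<omega>)"
    using T by (intro Bochner_Integration.integrable_add) (auto simp: has_bochner_integral_iff)
  then have "expectation Z - \<tau> = expectation (\<lambda>\<omega>. Z \<omega> - T \<omega>)"
    using T by (simp add: has_bochner_integral_iff)
  then have "\<bar>expectation Z - \<tau>\<bar> \<le> expectation (\<lambda>\<omega>. \<bar>Z \<omega> - T \<omega>\<bar>)"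
    by simp
  also have "\<dots> \<le> expectation (\<lambda>\<omega>. B \<omega> + C * indicator A \<omega>)"
    using diff dom bound by (intro integral_mono_AE) auto
  also have "\<dots> = \<beta> + C * prob A"
    using B iA by (simp add: has_bochner_integral_iff)
  also have "\<dots> \<le> \<beta> + C * chernoff_rate ^ p"
    using prob_\<epsilon>_small nonneg(2) unfolding A_def by (intro add_left_mono mult_left_mono) auto
  finally show ?thesis .
qed

section \<open>Consequences of positivity and the expected Taylor remainder\<close>

lemma S_moment_bounds:
  shows "(real p - 2) * m 2 \<le> real p * m 2"
    and "(real p - 2) * m 4 + 3 * (real p - 2) * (real p - 3) * (m 2)\<^sup>2 \<le> (real p)\<^sup>2 * (m 4 + 3 * (m 2)\<^sup>2)"
proof -
  show "(real p - 2) * m 2 \<le> real p * m 2"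
    using m2_nonneg by (intro mult_right_mono) auto
  have "(real p - 2) * m 4 \<le> (real p)\<^sup>2 * m 4"
    using m4_nonneg p_ge_2 zero_le_power2[of "real p - 1 / 2"]
    by (intro mult_right_mono) (auto simp: power2_eq_square algebra_simps)
  moreover have "(real p - 2) * (real p - 3) \<le> (real p)\<^sup>2"
    using p_ge_2 by (simp add: power2_eq_square algebra_simps)
  then have "(real p - 2) * (real p - 3) * (3 * (m 2)\<^sup>2) \<le> (real p)\<^sup>2 * (3 * (m 2)\<^sup>2)"
    by (intro mult_right_mono) auto
  ultimately show "(real p - 2) * m 4 + 3 * (real p - 2) * (real p - 3) * (m 2)\<^sup>2
      \<le> (real p)\<^sup>2 * (m 4 + 3 * (m 2)\<^sup>2)"
    by (simp add: algebra_simps)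
qed

lemma AE_mean_pos:
  "AE \<omega> in M. 1 + \<epsilon> \<omega> > 0 \<and> (\<forall>j\<in>{1..p}. X j \<omega> > -1 \<and> 1 + X j \<omega> \<le> real p * (1 + \<epsilon> \<omega>))"
proof -
  have "AE \<omega> in M. \<forall>j\<in>{1..p}. X j \<omega> > -1"
    using pos by (subst AE_finite_all) auto
  then show ?thesis
  proof eventually_elim
    case (elim \<omega>)
    have nn: "0 < 1 + X i \<omega>" if "i \<in> {1..p}" for i
      using bspec[OF elim that] by simp
    have eq: "real p * (1 + \<epsilon> \<omega>) = (\<Sum>j=1..p. 1 + X j \<omega>)"
      using p_ge_2 by (simp add: \<epsilon>_eq_mean sum.distrib algebra_simps)
    have "1 + X j \<omega> \<le> real p * (1 + \<epsilon> \<omega>)" if "j \<in> {1..p}" for j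
      unfolding eq using that nn by (intro member_le_sum) (auto intro: less_imp_le)
    moreover have "0 < real p * (1 + \<epsilon> \<omega>)"
      unfolding eq using nn p_ge_2 by (intro sum_pos) auto
    ultimately show ?case using elim p_ge_2 by (simp add: zero_less_mult_iff)
  qed
qed

text \<open>The first summand collects the parts from \<open>X 1\<close> and \<open>X 2\<close>,
  each with expectation \<open>(m 2 + m 4) * (1 + m 2)\<close> before scaling; the second collects
  the square and the fourth power of \<open>S\<close>.\<close>

definition remainder_const :: real where
  "remainder_const = 2 * (1 + m 2) * (m 2 + m 4) + (1 + m 2)\<^sup>2 * (m 2 + m 4 + 3 * (m 2)\<^sup>2)"

text \<open>\<open>B\<close> is the weight times the bound of \<open>min_square_cube_sum_le\<close>
  for the three parts of \<open>\<epsilon>\<close>, so it is a sum of products of functions of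
  \<open>X 1\<close>, \<open>X 2\<close> and \<open>S\<close>. The scaled second and fourth moments
  of \<open>S\<close> are of order 1/p and \<open>p\<^sup>-\<^sup>2\<close>; multiplying the first
  and dividing the second by \<open>\<delta> = 1 / sqrt p\<close> brings both to order
  \<open>p\<^sup>-\<^sup>3\<^sup>/\<^sup>2\<close>.\<close>

lemma taylor_remainder_moment:
  obtains B \<beta> where "has_bochner_integral M B \<beta>" "\<beta> \<le> remainder_const / (real p * sqrt (real p))"
    "\<And>\<omega>. (1 + (X 1 \<omega>)\<^sup>2) * (1 + (X 2 \<omega>)\<^sup>2) * min ((\<epsilon> \<omega>)\<^sup>2) (\<bar>\<epsilon> \<omega>\<bar> ^ 3) \<le> 8 * B \<omega>"
    "\<And>\<omega>. 0 \<le> B \<omega>"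
proof -
  define P where "P = real p"
  have P: "P \<ge> 2" using p_ge_2 by (simp add: P_def)
  define \<delta> where "\<delta> = 1 / sqrt P"
  have \<delta>: "\<delta> > 0" using P by (simp add: \<delta>_def)
  define r2 r4 where "r2 = (P - 2) * m 2" and "r4 = (P - 2) * m 4 + 3 * (P - 2) * (P - 3) * (m 2)\<^sup>2"
  define B where "B \<omega> = (1 + (X 1 \<omega>)\<^sup>2) * (1 + (X 2 \<omega>)\<^sup>2) *
    ((X 1 \<omega> / P)\<^sup>2 + (X 2 \<omega> / P)\<^sup>2 + (\<delta> * (S \<omega> / P)\<^sup>2 + (S \<omega> / P) ^ 4 / \<delta>))" for \<omega>
  define \<beta> where "\<beta> = 2 * (1 + m 2) * (m 2 + m 4) / P\<^sup>2
    + (1 + m 2)\<^sup>2 * (\<delta> * r2 / P\<^sup>2 + r4 / (\<delta> * P ^ 4))"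
  have q: "has_bochner_integral M (\<lambda>\<omega>. 1 + (X j \<omega>)\<^sup>2) (1 + m 2)" if "j \<in> {1..p}" for j
  proof -
    have "has_bochner_integral M (\<lambda>\<omega>. X j \<omega> ^ 0 + (X j \<omega>)\<^sup>2) (m 0 + m 2)"
      using that by (intro has_bochner_integral_add moment) auto
    then show ?thesis by (simp add: m0)
  qed
  have q': "has_bochner_integral M (\<lambda>\<omega>. (1 + (X j \<omega>)\<^sup>2) * (X j \<omega>)\<^sup>2) (m 2 + m 4)"
    if "j \<in> {1..p}" for j
  proof -
    have "has_bochner_integral M (\<lambda>\<omega>. (X j \<omega>)\<^sup>2 + X j \<omega> ^ 4) (m 2 + m 4)"
      using that by (intro has_bochner_integral_add moment) auto
    then show ?thesis by (simp add: algebra_simps eval_nat_numeral)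
  qed
  have j: "1 \<in> {1..p}" "2 \<in> {1..p}" using p_ge_2 by auto
  have S2: "has_bochner_integral M (\<lambda>\<omega>. S \<omega> ^ 2) r2" "has_bochner_integral M (\<lambda>\<omega>. S \<omega> ^ 4) r4"
    using S_moment2 S_moment4 by (simp_all add: r2_def r4_def P_def)
  \<comment> \<open>\<open>B\<close> multiplied out into products of the shape required by
    \<open>integral_X1_X2_S\<close>; \<open>S \<omega> ^ 0\<close> fills the third slot where
    \<open>S\<close> is absent.\<close>
  have "has_bochner_integral M (\<lambda>\<omega>.
      (1 / P\<^sup>2) * ((1 + (X 1 \<omega>)\<^sup>2) * (X 1 \<omega>)\<^sup>2 * (1 + (X 2 \<omega>)\<^sup>2) * S \<omega> ^ 0)
    + (1 / P\<^sup>2) * ((1 + (X 1 \<omega>)\<^sup>2) * ((1 + (X 2 \<omega>)\<^sup>2) * (X 2 \<omega>)\<^sup>2) * S \<omega> ^ 0)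
    + (\<delta> / P\<^sup>2) * ((1 + (X 1 \<omega>)\<^sup>2) * (1 + (X 2 \<omega>)\<^sup>2) * S \<omega> ^ 2)
    + (1 / (\<delta> * P ^ 4)) * ((1 + (X 1 \<omega>)\<^sup>2) * (1 + (X 2 \<omega>)\<^sup>2) * S \<omega> ^ 4))
    ((1 / P\<^sup>2) * ((m 2 + m 4) * (1 + m 2) * 1) + (1 / P\<^sup>2) * ((1 + m 2) * (m 2 + m 4) * 1)
     + (\<delta> / P\<^sup>2) * ((1 + m 2) * (1 + m 2) * r2) + (1 / (\<delta> * P ^ 4)) * ((1 + m 2) * (1 + m 2) * r4))"
    apply (intro has_bochner_integral_add has_bochner_integral_mult_right)
    subgoal by (rule integral_X1_X2_S[where f = "\<lambda>x. (1 + x\<^sup>2) * x\<^sup>2" and g = "\<lambda>x. 1 + x\<^sup>2" and h = "\<lambda>x. x ^ 0",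
          OF _ _ _ q'[OF j(1)] q[OF j(2)] S_moment0]) measurable
    subgoal by (rule integral_X1_X2_S[where f = "\<lambda>x. 1 + x\<^sup>2" and g = "\<lambda>x. (1 + x\<^sup>2) * x\<^sup>2" and h = "\<lambda>x. x ^ 0",
          OF _ _ _ q[OF j(1)] q'[OF j(2)] S_moment0]) measurable
    subgoal by (rule integral_X1_X2_S[where f = "\<lambda>x. 1 + x\<^sup>2" and g = "\<lambda>x. 1 + x\<^sup>2" and h = "\<lambda>x. x ^ 2",
          OF _ _ _ q[OF j(1)] q[OF j(2)] S2(1)]) measurable
    subgoal by (rule integral_X1_X2_S[where f = "\<lambda>x. 1 + x\<^sup>2" and g = "\<lambda>x. 1 + x\<^sup>2" and h = "\<lambda>x. x ^ 4",
          OF _ _ _ q[OF j(1)] q[OF j(2)] S2(2)]) measurable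
    done
  also have "(1 / P\<^sup>2) * ((m 2 + m 4) * (1 + m 2) * 1) + (1 / P\<^sup>2) * ((1 + m 2) * (m 2 + m 4) * 1)
     + (\<delta> / P\<^sup>2) * ((1 + m 2) * (1 + m 2) * r2) + (1 / (\<delta> * P ^ 4)) * ((1 + m 2) * (1 + m 2) * r4) = \<beta>"
    unfolding \<beta>_def using \<delta> P by (simp add: power2_eq_square algebra_simps add_divide_distrib)
  also have "(\<lambda>\<omega>.
      (1 / P\<^sup>2) * ((1 + (X 1 \<omega>)\<^sup>2) * (X 1 \<omega>)\<^sup>2 * (1 + (X 2 \<omega>)\<^sup>2) * S \<omega> ^ 0)
    + (1 / P\<^sup>2) * ((1 + (X 1 \<omega>)\<^sup>2) * ((1 + (X 2 \<omega>)\<^sup>2) * (X 2 \<omega>)\<^sup>2) * S \<omega> ^ 0)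
    + (\<delta> / P\<^sup>2) * ((1 + (X 1 \<omega>)\<^sup>2) * (1 + (X 2 \<omega>)\<^sup>2) * S \<omega> ^ 2)
    + (1 / (\<delta> * P ^ 4)) * ((1 + (X 1 \<omega>)\<^sup>2) * (1 + (X 2 \<omega>)\<^sup>2) * S \<omega> ^ 4)) = B"
  proof
    fix \<omega>
    have "(1 / c) * (a * u * b * 1) + (1 / c) * (a * (b * v) * 1) + (\<delta> / c) * (a * b * s) + (1 / (\<delta> * d)) * (a * b * w)
      = a * b * (u / c + v / c + (\<delta> * (s / c) + w / d / \<delta>))" for a b c d u v w s
      by (simp add: algebra_simps)
    then show "(1 / P\<^sup>2) * ((1 + (X 1 \<omega>)\<^sup>2) * (X 1 \<omega>)\<^sup>2 * (1 + (X 2 \<omega>)\<^sup>2) * S \<omega> ^ 0)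
      + (1 / P\<^sup>2) * ((1 + (X 1 \<omega>)\<^sup>2) * ((1 + (X 2 \<omega>)\<^sup>2) * (X 2 \<omega>)\<^sup>2) * S \<omega> ^ 0)
      + (\<delta> / P\<^sup>2) * ((1 + (X 1 \<omega>)\<^sup>2) * (1 + (X 2 \<omega>)\<^sup>2) * S \<omega> ^ 2)
      + (1 / (\<delta> * P ^ 4)) * ((1 + (X 1 \<omega>)\<^sup>2) * (1 + (X 2 \<omega>)\<^sup>2) * S \<omega> ^ 4) = B \<omega>"
      unfolding B_def power_divide power_0 .
  qed
  finally have "has_bochner_integral M B \<beta>" .
  moreover have "\<beta> \<le> remainder_const / (P * sqrt P)"
  proof -
    have sq: "sqrt P * sqrt P = P" using P by simp
    \<comment> \<open>The contribution of \<open>X 1\<close> and \<open>X 2\<close> is of the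
      smaller order \<open>P\<^sup>-\<^sup>2\<close> and is absorbed into the rate of
      \<open>S\<close>.\<close>
    have "sqrt P \<le> P" using P real_sqrt_le_mono[of P "P\<^sup>2"] by (simp add: power2_eq_square)
    then have "1 / P\<^sup>2 \<le> 1 / (P * sqrt P)"
      using P by (intro divide_left_mono) (auto simp: power2_eq_square)
    then have 1: "2 * (1 + m 2) * (m 2 + m 4) * (1 / P\<^sup>2) \<le> 2 * (1 + m 2) * (m 2 + m 4) * (1 / (P * sqrt P))"
      using m2_nonneg m4_nonneg by (intro mult_left_mono) auto
    have "\<delta> * r2 / P\<^sup>2 \<le> \<delta> * (P * m 2) / P\<^sup>2"
      using S_moment_bounds(1) \<delta> by (intro divide_right_mono mult_left_mono) (auto simp: r2_def P_def)
    also have "\<dots> = m 2 * (1 / (P * sqrt P))"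
      using P by (simp add: \<delta>_def power2_eq_square)
    finally have 2: "\<delta> * r2 / P\<^sup>2 \<le> m 2 * (1 / (P * sqrt P))" .
    have "r4 / (\<delta> * P ^ 4) \<le> P\<^sup>2 * (m 4 + 3 * (m 2)\<^sup>2) / (\<delta> * P ^ 4)"
      using S_moment_bounds(2) \<delta> P by (intro divide_right_mono) (auto simp: r4_def P_def)
    also have "\<dots> = (m 4 + 3 * (m 2)\<^sup>2) * (sqrt P / P\<^sup>2)"
      using P by (simp add: \<delta>_def power4_eq_xxxx power2_eq_square)
    also have "sqrt P / P\<^sup>2 = 1 / (P * sqrt P)"
      using P sq by (simp add: field_simps power2_eq_square)
    finally have 3: "r4 / (\<delta> * P ^ 4) \<le> (m 4 + 3 * (m 2)\<^sup>2) * (1 / (P * sqrt P))" .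
    have "(1 + m 2)\<^sup>2 * (\<delta> * r2 / P\<^sup>2 + r4 / (\<delta> * P ^ 4))
        \<le> (1 + m 2)\<^sup>2 * (m 2 * (1 / (P * sqrt P)) + (m 4 + 3 * (m 2)\<^sup>2) * (1 / (P * sqrt P)))"
      by (intro mult_left_mono add_mono 2 3) auto
    then have "\<beta> \<le> 2 * (1 + m 2) * (m 2 + m 4) * (1 / (P * sqrt P))
        + (1 + m 2)\<^sup>2 * (m 2 * (1 / (P * sqrt P)) + (m 4 + 3 * (m 2)\<^sup>2) * (1 / (P * sqrt P)))"
      unfolding \<beta>_def using 1 by simp
    also have "\<dots> = remainder_const * (1 / (P * sqrt P))"
      unfolding remainder_const_def by (simp only: algebra_simps)
    finally show ?thesis by simp
  qed
  moreover have "(1 + (X 1 \<omega>)\<^sup>2) * (1 + (X 2 \<omega>)\<^sup>2) * min ((\<epsilon> \<omega>)\<^sup>2) (\<bar>\<epsilon> \<omega>\<bar> ^ 3) \<le> 8 * B \<omega>" for \<omega>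
  proof -
    have "\<epsilon> \<omega> = X 1 \<omega> / P + X 2 \<omega> / P + S \<omega> / P"
      by (simp add: \<epsilon>_def P_def add_divide_distrib)
    from min_square_cube_sum_le[OF this \<delta>]
    have "(1 + (X 1 \<omega>)\<^sup>2) * (1 + (X 2 \<omega>)\<^sup>2) * min ((\<epsilon> \<omega>)\<^sup>2) (\<bar>\<epsilon> \<omega>\<bar> ^ 3)
      \<le> (1 + (X 1 \<omega>)\<^sup>2) * (1 + (X 2 \<omega>)\<^sup>2) *
        (8 * ((X 1 \<omega> / P)\<^sup>2 + (X 2 \<omega> / P)\<^sup>2 + (\<delta> * (S \<omega> / P)\<^sup>2 + (S \<omega> / P) ^ 4 / \<delta>)))"
      by (intro mult_left_mono) auto
    then show ?thesis unfolding B_def by (simp only: mult_ac)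
  qed
  moreover have "0 \<le> B \<omega>" for \<omega>
    unfolding B_def using \<delta> by (intro mult_nonneg_nonneg add_nonneg_nonneg) auto
  ultimately show ?thesis using that unfolding P_def by blast
qed

section \<open>Expansions for the normalised sample\<close>

text \<open>The \<open>p\<^sup>-\<^sup>2\<close> coefficient in the expectation of \<open>X 1 ^ i * X 2 ^ j * \<epsilon>\<^sup>2\<close>.\<close>

definition eps2_coeff :: "nat \<Rightarrow> nat \<Rightarrow> real" where
  "eps2_coeff i j = m (i + 2) * m j + 2 * (m (i + 1) * m (j + 1)) + m i * m (j + 2) - 2 * m 2 * m i * m j"

text \<open>The 1/p coefficient arises as \<open>- 2 * m 2\<close> from
  \<open>u * \<epsilon>\<close>, \<open>- 2 * m 3\<close> from
  \<open>u\<^sup>2 * \<epsilon>\<close>, \<open>m 2\<close> from \<open>\<epsilon>\<^sup>2\<close>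
  and \<open>3 * (m 2)\<^sup>2\<close> from \<open>u\<^sup>2 * \<epsilon>\<^sup>2\<close>. The term
  with \<open>u * \<epsilon>\<^sup>2\<close> has none, since \<open>m 1 = 0\<close>.\<close>

lemma taylor2_moment:
  "has_bochner_integral M (\<lambda>\<omega>. taylor2 (X 1 \<omega>) (\<epsilon> \<omega>))
    (m 2 + (3 * (m 2)\<^sup>2 - m 2 - 2 * m 3) / real p + (eps2_coeff 0 0 + 4 * eps2_coeff 1 0 + 3 * eps2_coeff 2 0) / (real p)\<^sup>2)"
proof -
  define E where "E i j k \<omega> = X 1 \<omega> ^ i * X 2 \<omega> ^ j * \<epsilon> \<omega> ^ k" for i j k \<omega>
  note E = monomial_moment_\<epsilon>0[folded E_def] monomial_moment_\<epsilon>1[folded E_def]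
    monomial_moment_\<epsilon>2[folded E_def, folded eps2_coeff_def]
  have "has_bochner_integral M (\<lambda>\<omega>. E 2 0 0 \<omega> - 2 * E 1 0 1 \<omega> - 2 * E 2 0 1 \<omega>
      + E 0 0 2 \<omega> + 4 * E 1 0 2 \<omega> + 3 * E 2 0 2 \<omega>)
    (m 2 * m 0
     - 2 * ((m (1 + 1) * m 0 + m 1 * m (0 + 1)) / real p)
     - 2 * ((m (2 + 1) * m 0 + m 2 * m (0 + 1)) / real p)
     + (m 2 * m 0 * m 0 / real p + eps2_coeff 0 0 / (real p)\<^sup>2)
     + 4 * (m 2 * m 1 * m 0 / real p + eps2_coeff 1 0 / (real p)\<^sup>2)
     + 3 * (m 2 * m 2 * m 0 / real p + eps2_coeff 2 0 / (real p)\<^sup>2))"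
    by (intro has_bochner_integral_add has_bochner_integral_diff has_bochner_integral_mult_right E) auto
  also have "(m 2 * m 0
     - 2 * ((m (1 + 1) * m 0 + m 1 * m (0 + 1)) / real p)
     - 2 * ((m (2 + 1) * m 0 + m 2 * m (0 + 1)) / real p)
     + (m 2 * m 0 * m 0 / real p + eps2_coeff 0 0 / (real p)\<^sup>2)
     + 4 * (m 2 * m 1 * m 0 / real p + eps2_coeff 1 0 / (real p)\<^sup>2)
     + 3 * (m 2 * m 2 * m 0 / real p + eps2_coeff 2 0 / (real p)\<^sup>2))
    = m 2 + (3 * (m 2)\<^sup>2 - m 2 - 2 * m 3) / real p + (eps2_coeff 0 0 + 4 * eps2_coeff 1 0 + 3 * eps2_coeff 2 0) / (real p)\<^sup>2"
    using centered by (simp add: m0 power2_eq_square add_divide_distrib diff_divide_distrib eval_nat_numeral)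
  also have "(\<lambda>\<omega>. E 2 0 0 \<omega> - 2 * E 1 0 1 \<omega> - 2 * E 2 0 1 \<omega>
      + E 0 0 2 \<omega> + 4 * E 1 0 2 \<omega> + 3 * E 2 0 2 \<omega>) = (\<lambda>\<omega>. taylor2 (X 1 \<omega>) (\<epsilon> \<omega>))"
    by (simp add: fun_eq_iff E_def taylor2_def)
  finally show ?thesis .
qed

text \<open>At order 1/p, \<open>u\<^sup>2 * v\<^sup>2\<close> gives \<open>- 8 * m 3 * m 2\<close>
  with \<open>\<epsilon>\<close> and \<open>10 * m 2 ^ 3\<close> with
  \<open>\<epsilon>\<^sup>2\<close>. The \<open>- 2 * (m 2)\<^sup>2\<close> combines -4 from the
  cubic monomials times \<open>\<epsilon>\<close> with +2 from
  \<open>(u\<^sup>2 + v\<^sup>2) * \<epsilon>\<^sup>2\<close>; the other terms contain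
  \<open>m 1\<close>.\<close>

lemma taylor12_moment:
  "has_bochner_integral M (\<lambda>\<omega>. taylor12 (X 1 \<omega>) (X 2 \<omega>) (\<epsilon> \<omega>))
    ((m 2)\<^sup>2 + (10 * m 2 ^ 3 - 2 * (m 2)\<^sup>2 - 8 * m 3 * m 2) / real p
     + (10 * eps2_coeff 2 2 + 8 * eps2_coeff 2 1 + 8 * eps2_coeff 1 2 + eps2_coeff 2 0 + eps2_coeff 0 2 + 4 * eps2_coeff 1 1) / (real p)\<^sup>2)"
proof -
  define E where "E i j k \<omega> = X 1 \<omega> ^ i * X 2 \<omega> ^ j * \<epsilon> \<omega> ^ k" for i j k \<omega>
  note E = monomial_moment_\<epsilon>0[folded E_def] monomial_moment_\<epsilon>1[folded E_def]
    monomial_moment_\<epsilon>2[folded E_def, folded eps2_coeff_def]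
  have "has_bochner_integral M (\<lambda>\<omega>. E 2 2 0 \<omega> - 4 * E 2 2 1 \<omega> - 2 * E 2 1 1 \<omega> - 2 * E 1 2 1 \<omega>
      + 10 * E 2 2 2 \<omega> + 8 * E 2 1 2 \<omega> + 8 * E 1 2 2 \<omega> + E 2 0 2 \<omega> + E 0 2 2 \<omega> + 4 * E 1 1 2 \<omega>)
    (m 2 * m 2
     - 4 * ((m (2 + 1) * m 2 + m 2 * m (2 + 1)) / real p)
     - 2 * ((m (2 + 1) * m 1 + m 2 * m (1 + 1)) / real p)
     - 2 * ((m (1 + 1) * m 2 + m 1 * m (2 + 1)) / real p)
     + 10 * (m 2 * m 2 * m 2 / real p + eps2_coeff 2 2 / (real p)\<^sup>2)
     + 8 * (m 2 * m 2 * m 1 / real p + eps2_coeff 2 1 / (real p)\<^sup>2)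
     + 8 * (m 2 * m 1 * m 2 / real p + eps2_coeff 1 2 / (real p)\<^sup>2)
     + (m 2 * m 2 * m 0 / real p + eps2_coeff 2 0 / (real p)\<^sup>2)
     + (m 2 * m 0 * m 2 / real p + eps2_coeff 0 2 / (real p)\<^sup>2)
     + 4 * (m 2 * m 1 * m 1 / real p + eps2_coeff 1 1 / (real p)\<^sup>2))"
    by (intro has_bochner_integral_add has_bochner_integral_diff has_bochner_integral_mult_right E) auto
  also have "(m 2 * m 2
     - 4 * ((m (2 + 1) * m 2 + m 2 * m (2 + 1)) / real p)
     - 2 * ((m (2 + 1) * m 1 + m 2 * m (1 + 1)) / real p)
     - 2 * ((m (1 + 1) * m 2 + m 1 * m (2 + 1)) / real p)
     + 10 * (m 2 * m 2 * m 2 / real p + eps2_coeff 2 2 / (real p)\<^sup>2)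
     + 8 * (m 2 * m 2 * m 1 / real p + eps2_coeff 2 1 / (real p)\<^sup>2)
     + 8 * (m 2 * m 1 * m 2 / real p + eps2_coeff 1 2 / (real p)\<^sup>2)
     + (m 2 * m 2 * m 0 / real p + eps2_coeff 2 0 / (real p)\<^sup>2)
     + (m 2 * m 0 * m 2 / real p + eps2_coeff 0 2 / (real p)\<^sup>2)
     + 4 * (m 2 * m 1 * m 1 / real p + eps2_coeff 1 1 / (real p)\<^sup>2))
    = (m 2)\<^sup>2 + (10 * m 2 ^ 3 - 2 * (m 2)\<^sup>2 - 8 * m 3 * m 2) / real p
     + (10 * eps2_coeff 2 2 + 8 * eps2_coeff 2 1 + 8 * eps2_coeff 1 2 + eps2_coeff 2 0 + eps2_coeff 0 2 + 4 * eps2_coeff 1 1) / (real p)\<^sup>2"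
    using centered
    by (simp add: m0 power2_eq_square power3_eq_cube add_divide_distrib diff_divide_distrib eval_nat_numeral mult_ac)
  also have "(\<lambda>\<omega>. E 2 2 0 \<omega> - 4 * E 2 2 1 \<omega> - 2 * E 2 1 1 \<omega> - 2 * E 1 2 1 \<omega>
      + 10 * E 2 2 2 \<omega> + 8 * E 2 1 2 \<omega> + 8 * E 1 2 2 \<omega> + E 2 0 2 \<omega> + E 0 2 2 \<omega> + 4 * E 1 1 2 \<omega>)
     = (\<lambda>\<omega>. taylor12 (X 1 \<omega>) (X 2 \<omega>) (\<epsilon> \<omega>))"
    by (simp add: fun_eq_iff E_def taylor12_def algebra_simps)
  finally show ?thesis .
qed

text \<open>In this form, rather than as \<open>(X j - \<epsilon>) / (1 + \<epsilon>)\<close>, it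
  agrees with \<open>w j / w_mean p w - 1\<close> at every point, even where the mean is zero and
  the division takes its default value.\<close>

definition rel_dev :: "nat \<Rightarrow> 'a \<Rightarrow> real" where
  "rel_dev j \<omega> = (1 + X j \<omega>) / (1 + \<epsilon> \<omega>) - 1"

lemma rel_dev_eq: "rel_dev j \<omega> = (X j \<omega> - \<epsilon> \<omega>) / (1 + \<epsilon> \<omega>)" if "- 1 / 2 \<le> \<epsilon> \<omega>"
proof -
  have "1 + \<epsilon> \<omega> \<noteq> 0" using that by auto
  then show ?thesis by (simp add: rel_dev_def field_simps)
qed

lemma rel_dev_measurable [measurable]: "rel_dev 1 \<in> borel_measurable M" "rel_dev (Suc 0) \<in> borel_measurable M"
  "rel_dev 2 \<in> borel_measurable M"
  unfolding rel_dev_def[abs_def] by measurable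

text \<open>On this event \<open>1 + \<epsilon>\<close> lies between 0 and 1/2, so
  \<open>1 + X j \<le> p * (1 + \<epsilon>)\<close> bounds both \<open>X j\<close> and the ratio.
  These are the hypotheses of the crude polynomial bounds.\<close>

lemma AE_small_bounds:
  "AE \<omega> in M. \<epsilon> \<omega> < - 1 / 2 \<longrightarrow> \<bar>\<epsilon> \<omega>\<bar> \<le> 1 \<and>
    (\<forall>j\<in>{1..p}. \<bar>X j \<omega>\<bar> \<le> real p \<and> \<bar>rel_dev j \<omega>\<bar> \<le> real p)"
  using AE_mean_pos
proof eventually_elim
  case (elim \<omega>)
  show ?case
  proof (intro impI conjI ballI)
    assume small: "\<epsilon> \<omega> < - 1 / 2"
    then show "\<bar>\<epsilon> \<omega>\<bar> \<le> 1" using elim by auto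
    fix j assume j: "j \<in> {1..p}"
    have X: "X j \<omega> > -1" "1 + X j \<omega> \<le> real p * (1 + \<epsilon> \<omega>)" using elim j by auto
    have "real p * (1 + \<epsilon> \<omega>) \<le> real p * 1" using small by (intro mult_left_mono) auto
    then have "X j \<omega> \<le> real p" using X(2) by simp
    moreover have "- X j \<omega> \<le> real p" using X(1) p_ge_2 by simp
    ultimately show "\<bar>X j \<omega>\<bar> \<le> real p" by (simp add: abs_le_iff)
    have "(1 + X j \<omega>) / (1 + \<epsilon> \<omega>) \<le> real p" using X elim by (simp add: divide_le_eq)
    moreover have "0 < (1 + X j \<omega>) / (1 + \<epsilon> \<omega>)" using X elim by auto
    ultimately show "\<bar>rel_dev j \<omega>\<bar> \<le> real p" unfolding rel_dev_def using p_ge_2 by auto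
  qed
qed

text \<open>The constants are 320 * 8, with 8 from \<open>taylor_remainder_moment\<close>, and 13 +
  1, where the 1 accounts for \<open>rel_dev 1\<close> squared. The \<open>p\<^sup>-\<^sup>2\<close>
  part of the expected Taylor polynomial is moved into the error.\<close>

lemma square_ratio_expansion:
  "\<bar>expectation (\<lambda>\<omega>. (rel_dev 1 \<omega>)\<^sup>2) - (m 2 + (3 * (m 2)\<^sup>2 - m 2 - 2 * m 3) / real p)\<bar>
    \<le> 2560 * remainder_const / (real p * sqrt (real p)) + \<bar>eps2_coeff 0 0 + 4 * eps2_coeff 1 0 + 3 * eps2_coeff 2 0\<bar> / (real p)\<^sup>2
      + 14 * real p ^ 4 * chernoff_rate ^ p"
proof -
  obtain B \<beta> where B: "has_bochner_integral M B \<beta>" "\<beta> \<le> remainder_const / (real p * sqrt (real p))"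
    "\<And>\<omega>. (1 + (X 1 \<omega>)\<^sup>2) * (1 + (X 2 \<omega>)\<^sup>2) * min ((\<epsilon> \<omega>)\<^sup>2) (\<bar>\<epsilon> \<omega>\<bar> ^ 3) \<le> 8 * B \<omega>"
    "\<And>\<omega>. 0 \<le> B \<omega>"
    by (rule taylor_remainder_moment) auto
  have p1: "1 \<le> real p" using p_ge_2 by simp
  have "\<bar>expectation (\<lambda>\<omega>. (rel_dev 1 \<omega>)\<^sup>2) - (m 2 + (3 * (m 2)\<^sup>2 - m 2 - 2 * m 3) / real p
      + (eps2_coeff 0 0 + 4 * eps2_coeff 1 0 + 3 * eps2_coeff 2 0) / (real p)\<^sup>2)\<bar>
    \<le> 2560 * \<beta> + 14 * real p ^ 4 * chernoff_rate ^ p"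
  proof (rule integral_approx[OF _ taylor2_moment has_bochner_integral_mult_right[OF B(1)]])
    show "AE \<omega> in M. - 1 / 2 \<le> \<epsilon> \<omega> \<longrightarrow> \<bar>(rel_dev 1 \<omega>)\<^sup>2 - taylor2 (X 1 \<omega>) (\<epsilon> \<omega>)\<bar> \<le> 2560 * B \<omega>"
    proof (rule AE_I2, rule impI)
      fix \<omega> assume \<epsilon>: "- 1 / 2 \<le> \<epsilon> \<omega>"
      from square_quotient_taylor[OF \<epsilon>, of "X 1 \<omega>"]
      have "\<bar>(rel_dev 1 \<omega>)\<^sup>2 - taylor2 (X 1 \<omega>) (\<epsilon> \<omega>)\<bar> \<le> 320 * ((1 + (X 1 \<omega>)\<^sup>2) * 1 * min ((\<epsilon> \<omega>)\<^sup>2) (\<bar>\<epsilon> \<omega>\<bar> ^ 3))"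
        by (simp add: rel_dev_eq[OF \<epsilon>])
      \<comment> \<open>The idle factor 1 is raised to \<open>1 + (X 2 \<omega>)\<^sup>2\<close>, so
        that the \<open>B\<close> built for the product serves here too.\<close>
      also have "\<dots> \<le> 320 * ((1 + (X 1 \<omega>)\<^sup>2) * (1 + (X 2 \<omega>)\<^sup>2) * min ((\<epsilon> \<omega>)\<^sup>2) (\<bar>\<epsilon> \<omega>\<bar> ^ 3))"
        by (intro mult_left_mono mult_right_mono) auto
      also have "\<dots> \<le> 2560 * B \<omega>" using B(3)[of \<omega>] B(4)[of \<omega>] by linarith
      finally show "\<bar>(rel_dev 1 \<omega>)\<^sup>2 - taylor2 (X 1 \<omega>) (\<epsilon> \<omega>)\<bar> \<le> 2560 * B \<omega>" .
    qed
    show "AE \<omega> in M. \<epsilon> \<omega> < - 1 / 2 \<longrightarrow> \<bar>(rel_dev 1 \<omega>)\<^sup>2 - taylor2 (X 1 \<omega>) (\<epsilon> \<omega>)\<bar> \<le> 14 * real p ^ 4"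
      using AE_small_bounds
    proof eventually_elim
      case (elim \<omega>)
      show ?case
      proof
        assume "\<epsilon> \<omega> < - 1 / 2"
        then have b: "\<bar>\<epsilon> \<omega>\<bar> \<le> 1" "\<bar>X 1 \<omega>\<bar> \<le> real p" "\<bar>rel_dev 1 \<omega>\<bar> \<le> real p"
          using elim p_ge_2 by auto
        have "(rel_dev 1 \<omega>)\<^sup>2 \<le> (real p)\<^sup>2" using power_mono[OF b(3), of 2] by simp
        also have "\<dots> \<le> real p ^ 4" using p_ge_2 by (intro power_increasing) auto
        finally show "\<bar>(rel_dev 1 \<omega>)\<^sup>2 - taylor2 (X 1 \<omega>) (\<epsilon> \<omega>)\<bar> \<le> 14 * real p ^ 4"
          using abs_taylor2_le[OF b(2) b(1) p1] zero_le_power2[of "rel_dev 1 \<omega>"] unfolding abs_le_iff by linarith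
      qed
    qed
  qed (use B(4) in auto)
  also have "\<dots> \<le> 2560 * remainder_const / (real p * sqrt (real p)) + 14 * real p ^ 4 * chernoff_rate ^ p"
    using B(2) by simp
  finally have 1: "\<bar>expectation (\<lambda>\<omega>. (rel_dev 1 \<omega>)\<^sup>2) - (m 2 + (3 * (m 2)\<^sup>2 - m 2 - 2 * m 3) / real p
      + (eps2_coeff 0 0 + 4 * eps2_coeff 1 0 + 3 * eps2_coeff 2 0) / (real p)\<^sup>2)\<bar>
      \<le> 2560 * remainder_const / (real p * sqrt (real p)) + 14 * real p ^ 4 * chernoff_rate ^ p" .
  have "\<bar>(eps2_coeff 0 0 + 4 * eps2_coeff 1 0 + 3 * eps2_coeff 2 0) / (real p)\<^sup>2\<bar> = \<bar>eps2_coeff 0 0 + 4 * eps2_coeff 1 0 + 3 * eps2_coeff 2 0\<bar> / (real p)\<^sup>2"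
    by simp
  with 1 show ?thesis unfolding abs_le_iff by argo
qed

text \<open>The argument of \<open>square_ratio_expansion\<close> with \<open>taylor12\<close>: the
  constants are 8000 * 8 and 41 + 1.\<close>

lemma square_product_ratio_expansion:
  "\<bar>expectation (\<lambda>\<omega>. (rel_dev 1 \<omega>)\<^sup>2 * (rel_dev 2 \<omega>)\<^sup>2)
      - ((m 2)\<^sup>2 + (10 * m 2 ^ 3 - 2 * (m 2)\<^sup>2 - 8 * m 3 * m 2) / real p)\<bar>
    \<le> 64000 * remainder_const / (real p * sqrt (real p))
      + \<bar>10 * eps2_coeff 2 2 + 8 * eps2_coeff 2 1 + 8 * eps2_coeff 1 2 + eps2_coeff 2 0 + eps2_coeff 0 2 + 4 * eps2_coeff 1 1\<bar> / (real p)\<^sup>2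
      + 42 * real p ^ 4 * chernoff_rate ^ p"
proof -
  obtain B \<beta> where B: "has_bochner_integral M B \<beta>" "\<beta> \<le> remainder_const / (real p * sqrt (real p))"
    "\<And>\<omega>. (1 + (X 1 \<omega>)\<^sup>2) * (1 + (X 2 \<omega>)\<^sup>2) * min ((\<epsilon> \<omega>)\<^sup>2) (\<bar>\<epsilon> \<omega>\<bar> ^ 3) \<le> 8 * B \<omega>"
    "\<And>\<omega>. 0 \<le> B \<omega>"
    by (rule taylor_remainder_moment) auto
  have p1: "1 \<le> real p" using p_ge_2 by simp
  define c where "c = 10 * eps2_coeff 2 2 + 8 * eps2_coeff 2 1 + 8 * eps2_coeff 1 2 + eps2_coeff 2 0 + eps2_coeff 0 2 + 4 * eps2_coeff 1 1"
  have "\<bar>expectation (\<lambda>\<omega>. (rel_dev 1 \<omega>)\<^sup>2 * (rel_dev 2 \<omega>)\<^sup>2)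
      - ((m 2)\<^sup>2 + (10 * m 2 ^ 3 - 2 * (m 2)\<^sup>2 - 8 * m 3 * m 2) / real p + c / (real p)\<^sup>2)\<bar>
    \<le> 64000 * \<beta> + 42 * real p ^ 4 * chernoff_rate ^ p"
  proof (rule integral_approx[OF _ taylor12_moment[folded c_def] has_bochner_integral_mult_right[OF B(1)]])
    show "AE \<omega> in M. - 1 / 2 \<le> \<epsilon> \<omega> \<longrightarrow>
      \<bar>(rel_dev 1 \<omega>)\<^sup>2 * (rel_dev 2 \<omega>)\<^sup>2 - taylor12 (X 1 \<omega>) (X 2 \<omega>) (\<epsilon> \<omega>)\<bar> \<le> 64000 * B \<omega>"
    proof (rule AE_I2, rule impI)
      fix \<omega> assume \<epsilon>: "- 1 / 2 \<le> \<epsilon> \<omega>"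
      from square_product_quotient_taylor[OF \<epsilon>, of "X 1 \<omega>" "X 2 \<omega>"]
      show "\<bar>(rel_dev 1 \<omega>)\<^sup>2 * (rel_dev 2 \<omega>)\<^sup>2 - taylor12 (X 1 \<omega>) (X 2 \<omega>) (\<epsilon> \<omega>)\<bar> \<le> 64000 * B \<omega>"
        using B(3)[of \<omega>] unfolding rel_dev_eq[OF \<epsilon>] by linarith
    qed
    show "AE \<omega> in M. \<epsilon> \<omega> < - 1 / 2 \<longrightarrow>
      \<bar>(rel_dev 1 \<omega>)\<^sup>2 * (rel_dev 2 \<omega>)\<^sup>2 - taylor12 (X 1 \<omega>) (X 2 \<omega>) (\<epsilon> \<omega>)\<bar> \<le> 42 * real p ^ 4"
      using AE_small_bounds
    proof eventually_elim
      case (elim \<omega>)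
      show ?case
      proof
        assume "\<epsilon> \<omega> < - 1 / 2"
        then have b: "\<bar>\<epsilon> \<omega>\<bar> \<le> 1" "\<bar>X 1 \<omega>\<bar> \<le> real p" "\<bar>rel_dev 1 \<omega>\<bar> \<le> real p"
          "\<bar>X 2 \<omega>\<bar> \<le> real p" "\<bar>rel_dev 2 \<omega>\<bar> \<le> real p"
          using elim p_ge_2 by auto
        have "(rel_dev 1 \<omega>)\<^sup>2 * (rel_dev 2 \<omega>)\<^sup>2 \<le> (real p)\<^sup>2 * (real p)\<^sup>2"
          using power_mono[OF b(3), of 2] power_mono[OF b(5), of 2] by (intro mult_mono) auto
        then have "(rel_dev 1 \<omega>)\<^sup>2 * (rel_dev 2 \<omega>)\<^sup>2 \<le> real p ^ 4" by (simp flip: power_add)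
        moreover have "0 \<le> (rel_dev 1 \<omega>)\<^sup>2 * (rel_dev 2 \<omega>)\<^sup>2" by simp
        ultimately show "\<bar>(rel_dev 1 \<omega>)\<^sup>2 * (rel_dev 2 \<omega>)\<^sup>2 - taylor12 (X 1 \<omega>) (X 2 \<omega>) (\<epsilon> \<omega>)\<bar> \<le> 42 * real p ^ 4"
          using abs_taylor12_le[OF b(2) b(4) b(1) p1] unfolding abs_le_iff by linarith
      qed
    qed
  qed (use B(4) in auto)
  also have "\<dots> \<le> 64000 * remainder_const / (real p * sqrt (real p)) + 42 * real p ^ 4 * chernoff_rate ^ p"
    using B(2) by simp
  finally have 1: "\<bar>expectation (\<lambda>\<omega>. (rel_dev 1 \<omega>)\<^sup>2 * (rel_dev 2 \<omega>)\<^sup>2)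
      - ((m 2)\<^sup>2 + (10 * m 2 ^ 3 - 2 * (m 2)\<^sup>2 - 8 * m 3 * m 2) / real p + c / (real p)\<^sup>2)\<bar>
      \<le> 64000 * remainder_const / (real p * sqrt (real p)) + 42 * real p ^ 4 * chernoff_rate ^ p" .
  have "\<bar>c / (real p)\<^sup>2\<bar> = \<bar>c\<bar> / (real p)\<^sup>2" by simp
  with 1 show ?thesis unfolding c_def[symmetric] abs_le_iff by argo
qed

text \<open>Only the contribution of \<open>X 1\<close> to \<open>\<epsilon>\<close> is correlated
  with the weight \<open>1 + X 1 ^ 4\<close>. It stays truncated, with its expectation kept as the
  parameter \<open>\<kappa>\<close>; \<open>X 2\<close> and \<open>S\<close> are independent of the
  weight and give the rates 1/p and 1/sqrt p.\<close>

lemma fourth_power_ratio_bound: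
  assumes \<kappa>: "has_bochner_integral M (\<lambda>\<omega>. (1 + X 1 \<omega> ^ 4) * min 1 (\<bar>X 1 \<omega>\<bar> / real p)) \<kappa>"
  shows "\<bar>expectation (\<lambda>\<omega>. rel_dev 1 \<omega> ^ 4) - m 4\<bar>
    \<le> 640 * (\<kappa> + (1 + m 4) * (1 + m 2) / sqrt (real p) + (1 + m 4) * (1 + m 2) / real p)
      + 2 * real p ^ 4 * chernoff_rate ^ p"
proof -
  define P where "P = real p"
  have P: "P \<ge> 2" using p_ge_2 by (simp add: P_def)
  define \<delta> where "\<delta> = 1 / sqrt P"
  have \<delta>: "\<delta> > 0" using P by (simp add: \<delta>_def)
  define r2 where "r2 = (P - 2) * m 2"
  have j: "1 \<in> {1..p}" "2 \<in> {1..p}" using p_ge_2 by auto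
  have X1: "has_bochner_integral M (\<lambda>\<omega>. 1 + X 1 \<omega> ^ 4) (1 + m 4)"
  proof -
    have "has_bochner_integral M (\<lambda>\<omega>. X 1 \<omega> ^ 0 + X 1 \<omega> ^ 4) (m 0 + m 4)"
      using j by (intro has_bochner_integral_add moment) auto
    then show ?thesis by (simp add: m0)
  qed
  have X2: "has_bochner_integral M (\<lambda>\<omega>. X 2 \<omega> ^ 0 + X 2 \<omega> ^ 2) (m 0 + m 2)"
    using j by (intro has_bochner_integral_add moment) auto
  define B where "B \<omega> = 640 * ((1 + X 1 \<omega> ^ 4) * min 1 (\<bar>X 1 \<omega>\<bar> / P)
      + (1 / P) * ((1 + X 1 \<omega> ^ 4) * (X 2 \<omega> ^ 0 + X 2 \<omega> ^ 2) * S \<omega> ^ 0)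
      + \<delta> * ((1 + X 1 \<omega> ^ 4) * X 2 \<omega> ^ 0 * S \<omega> ^ 0)
      + (1 / (\<delta> * P\<^sup>2)) * ((1 + X 1 \<omega> ^ 4) * X 2 \<omega> ^ 0 * S \<omega> ^ 2))" for \<omega>
  define \<beta> where "\<beta> = 640 * (\<kappa> + (1 / P) * ((1 + m 4) * (m 0 + m 2) * 1) + \<delta> * ((1 + m 4) * m 0 * 1)
      + (1 / (\<delta> * P\<^sup>2)) * ((1 + m 4) * m 0 * r2))"
  have S2: "has_bochner_integral M (\<lambda>\<omega>. S \<omega> ^ 2) r2"
    using S_moment2 by (simp add: r2_def P_def)
  have B: "has_bochner_integral M B \<beta>"
    unfolding B_def[abs_def] \<beta>_def
    apply (intro has_bochner_integral_add has_bochner_integral_mult_right \<kappa>[folded P_def])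
    subgoal by (rule integral_X1_X2_S[where f = "\<lambda>x. 1 + x ^ 4" and g = "\<lambda>x. x ^ 0 + x ^ 2" and h = "\<lambda>x. x ^ 0",
          OF _ _ _ X1 X2 S_moment0]) measurable
    subgoal by (rule integral_X1_X2_S[where f = "\<lambda>x. 1 + x ^ 4" and g = "\<lambda>x. x ^ 0" and h = "\<lambda>x. x ^ 0",
          OF _ _ _ X1 moment[OF j(2)] S_moment0]) simp_all
    subgoal by (rule integral_X1_X2_S[where f = "\<lambda>x. 1 + x ^ 4" and g = "\<lambda>x. x ^ 0" and h = "\<lambda>x. x ^ 2",
          OF _ _ _ X1 moment[OF j(2)] S2]) simp_all
    done
  have B0: "0 \<le> B \<omega>" for \<omega>
    unfolding B_def using \<delta> P by (intro mult_nonneg_nonneg add_nonneg_nonneg) auto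
  have "\<bar>expectation (\<lambda>\<omega>. rel_dev 1 \<omega> ^ 4) - m 4\<bar> \<le> \<beta> + 2 * real p ^ 4 * chernoff_rate ^ p"
  proof (rule integral_approx[OF _ moment[OF j(1)] B])
    show "AE \<omega> in M. - 1 / 2 \<le> \<epsilon> \<omega> \<longrightarrow> \<bar>rel_dev 1 \<omega> ^ 4 - X 1 \<omega> ^ 4\<bar> \<le> B \<omega>"
    proof (rule AE_I2, rule impI)
      fix \<omega> assume \<epsilon>: "- 1 / 2 \<le> \<epsilon> \<omega>"
      from fourth_power_quotient_diff[OF \<epsilon>, of "X 1 \<omega>"]
      have "\<bar>rel_dev 1 \<omega> ^ 4 - X 1 \<omega> ^ 4\<bar> \<le> 640 * ((1 + X 1 \<omega> ^ 4) * min 1 \<bar>\<epsilon> \<omega>\<bar>)"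
        by (simp add: rel_dev_eq[OF \<epsilon>])
      also have "\<dots> \<le> 640 * ((1 + X 1 \<omega> ^ 4) * (min 1 (\<bar>X 1 \<omega>\<bar> / P)
          + (1 / P) * (1 + X 2 \<omega> ^ 2) + \<delta> + (1 / (\<delta> * P\<^sup>2)) * S \<omega> ^ 2))"
      proof (intro mult_left_mono)
        have "\<epsilon> \<omega> = X 1 \<omega> / P + X 2 \<omega> / P + S \<omega> / P"
          by (simp add: \<epsilon>_def P_def add_divide_distrib)
        then have e: "\<bar>\<epsilon> \<omega>\<bar> \<le> \<bar>X 1 \<omega> / P\<bar> + \<bar>X 2 \<omega> / P\<bar> + \<bar>S \<omega> / P\<bar>"
          using abs_triangle_ineq[of "X 1 \<omega> / P + X 2 \<omega> / P" "S \<omega> / P"]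
            abs_triangle_ineq[of "X 1 \<omega> / P" "X 2 \<omega> / P"] by simp
        have "\<bar>X 2 \<omega>\<bar> \<le> 1 + X 2 \<omega> ^ 2"
          using one_plus_abs_square_le[of "X 2 \<omega>"] zero_le_power2[of "X 2 \<omega>"]
          by (simp add: power2_eq_square algebra_simps)
        then have x2: "\<bar>X 2 \<omega> / P\<bar> \<le> (1 / P) * (1 + X 2 \<omega> ^ 2)"
          using P by (simp add: divide_right_mono)
        \<comment> \<open>Weighted AM-GM trades the absolute value for a square; with
          \<open>\<delta> = 1 / sqrt P\<close> both resulting terms are of order 1/sqrt P in the
          mean.\<close>
        have "0 \<le> (\<delta> - \<bar>S \<omega> / P\<bar>)\<^sup>2 / \<delta> + \<bar>S \<omega> / P\<bar>" using \<delta> by simp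
        also have "\<dots> = \<delta> + (S \<omega> / P)\<^sup>2 / \<delta> - \<bar>S \<omega> / P\<bar>"
        proof -
          have "(\<delta> - \<bar>a\<bar>)\<^sup>2 / \<delta> + \<bar>a\<bar> = \<delta> + a\<^sup>2 / \<delta> - \<bar>a\<bar>" for a
            using \<delta> by (simp add: field_simps power2_eq_square)
          then show ?thesis .
        qed
        also have "(S \<omega> / P)\<^sup>2 / \<delta> = (1 / (\<delta> * P\<^sup>2)) * S \<omega> ^ 2" by (simp add: power_divide)
        finally have s: "\<bar>S \<omega> / P\<bar> \<le> \<delta> + (1 / (\<delta> * P\<^sup>2)) * S \<omega> ^ 2" by simp
        have x1: "\<bar>X 1 \<omega> / P\<bar> = \<bar>X 1 \<omega>\<bar> / P" using P by simp
        have nn: "0 \<le> \<bar>X 2 \<omega> / P\<bar>" "0 \<le> \<bar>S \<omega> / P\<bar>" by simp_all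
        \<comment> \<open>The cap is kept on the part of \<open>X 1\<close> alone; the nonnegative
          remaining parts come out of the minimum.\<close>
        have "min 1 b \<le> min 1 a + C + D + F"
          if "b \<le> a + y + z" "y \<le> C" "z \<le> D + F" "0 \<le> y" "0 \<le> z" for a b y z C D F :: real
          using that by linarith
        from this[OF e[unfolded x1] x2 s nn]
        show "min 1 \<bar>\<epsilon> \<omega>\<bar> \<le> min 1 (\<bar>X 1 \<omega>\<bar> / P)
          + (1 / P) * (1 + X 2 \<omega> ^ 2) + \<delta> + (1 / (\<delta> * P\<^sup>2)) * S \<omega> ^ 2" .
      qed auto
      also have "\<dots> = B \<omega>" unfolding B_def by (simp add: algebra_simps add_divide_distrib)
      finally show "\<bar>rel_dev 1 \<omega> ^ 4 - X 1 \<omega> ^ 4\<bar> \<le> B \<omega>" .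
    qed
    show "AE \<omega> in M. \<epsilon> \<omega> < - 1 / 2 \<longrightarrow> \<bar>rel_dev 1 \<omega> ^ 4 - X 1 \<omega> ^ 4\<bar> \<le> 2 * real p ^ 4"
      using AE_small_bounds
    proof eventually_elim
      case (elim \<omega>)
      show ?case
      proof
        assume "\<epsilon> \<omega> < - 1 / 2"
        then have b: "\<bar>X 1 \<omega>\<bar> \<le> real p" "\<bar>rel_dev 1 \<omega>\<bar> \<le> real p"
          using elim p_ge_2 by auto
        have "X 1 \<omega> ^ 4 \<le> real p ^ 4" "rel_dev 1 \<omega> ^ 4 \<le> real p ^ 4"
          using power_mono[OF b(1), of 4] power_mono[OF b(2), of 4] by (simp_all add: power_even_abs)
        moreover have "0 \<le> X 1 \<omega> ^ 4" "0 \<le> rel_dev 1 \<omega> ^ 4" by simp_all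
        ultimately show "\<bar>rel_dev 1 \<omega> ^ 4 - X 1 \<omega> ^ 4\<bar> \<le> 2 * real p ^ 4"
          unfolding abs_le_iff by linarith
      qed
    qed
  qed (use B0 in auto)
  also have "\<beta> \<le> 640 * (\<kappa> + (1 + m 4) * (1 + m 2) / sqrt P + (1 + m 4) * (1 + m 2) / P)"
  proof -
    have "(1 / (\<delta> * P\<^sup>2)) * r2 \<le> (1 / (\<delta> * P\<^sup>2)) * (P * m 2)"
      using S_moment_bounds(1) \<delta> P by (intro mult_left_mono) (auto simp: r2_def P_def)
    also have "\<dots> = m 2 * (sqrt P / P)"
      using P by (simp add: \<delta>_def power2_eq_square)
    also have "sqrt P / P = 1 / sqrt P" using P by (simp add: field_simps)
    finally have "(1 + m 4) * ((1 / (\<delta> * P\<^sup>2)) * r2) \<le> (1 + m 4) * (m 2 * (1 / sqrt P))"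
      using m4_nonneg by (intro mult_left_mono) auto
    then have "\<kappa> + (1 / P) * ((1 + m 4) * (m 0 + m 2) * 1) + \<delta> * ((1 + m 4) * m 0 * 1)
        + (1 / (\<delta> * P\<^sup>2)) * ((1 + m 4) * m 0 * r2)
      \<le> \<kappa> + (1 + m 4) * (1 + m 2) / sqrt P + (1 + m 4) * (1 + m 2) / P"
      unfolding m0 by (simp add: \<delta>_def algebra_simps add_divide_distrib)
    then show ?thesis unfolding \<beta>_def by (rule mult_left_mono) simp
  qed
  finally show ?thesis unfolding P_def by simp
qed

end

section \<open>The asymptotic expansions\<close>

lemma smallo_inverse_of_bound:
  fixes f :: "nat \<Rightarrow> real"
  assumes bound: "\<And>p. p \<ge> 2 \<Longrightarrow> \<bar>f p\<bar> \<le> a / (real p * sqrt (real p)) + b / (real p)\<^sup>2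
      + c * real p ^ 4 * exp (- d) ^ p"
    and "d > 0"
  shows "f \<in> o(\<lambda>p. 1 / real p)"
proof -
  have cmult: "(\<lambda>p. k * u p) \<in> o(\<lambda>p. 1 / real p)" if "u \<in> o(\<lambda>p. 1 / real p)" for k and u :: "nat \<Rightarrow> real"
    using that by (cases "k = 0") simp_all
  have "(\<lambda>p. 1 / (real p * sqrt (real p))) \<in> o(\<lambda>p. 1 / real p)"
    "(\<lambda>p. 1 / (real p)\<^sup>2) \<in> o(\<lambda>p. 1 / real p)"
    "(\<lambda>p. real p ^ 4 * exp (- d * real p)) \<in> o(\<lambda>p. 1 / real p)"
    using assms(2) by real_asymp+
  then have g: "(\<lambda>p. a * (1 / (real p * sqrt (real p))) + b * (1 / (real p)\<^sup>2)
      + c * (real p ^ 4 * exp (- d * real p))) \<in> o(\<lambda>p. 1 / real p)" (is "?g \<in> _")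
    by (intro sum_in_smallo cmult)
  have "f \<in> O(?g)"
  proof (rule landau_o.big_mono)
    show "eventually (\<lambda>p. norm (f p) \<le> norm (?g p)) sequentially"
      using eventually_ge_at_top[of 2]
    proof eventually_elim
      case (elim p)
      have "exp (- d * real p) = exp (- d) ^ p"
        by (simp add: exp_of_nat_mult[symmetric] mult.commute)
      then have "\<bar>f p\<bar> \<le> ?g p" using bound[OF elim] by (simp add: mult.assoc)
      then show ?case by simp
    qed
  qed
  then show ?thesis using g by (rule landau_o.big_small_trans)
qed

theorem lemma4p3:
  fixes M :: "nat \<Rightarrow> 'a measure" and w :: "nat \<Rightarrow> nat \<Rightarrow> 'a \<Rightarrow> real"
    and D :: "real measure" and \<mu> \<sigma> :: real
  assumes "\<And>p. p \<ge> 1 \<Longrightarrow> prob_space (M p)"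
    and "\<And>p. p \<ge> 1 \<Longrightarrow> prob_space.indep_vars (M p) (\<lambda>_. borel) (w p) {1..p}"
    and "\<And>p j. j \<in> {1..p} \<Longrightarrow> distr (M p) borel (w p j) = D"
    and "\<And>p j. j \<in> {1..p} \<Longrightarrow> AE \<omega> in M p. w p j \<omega> > 0"
    and "(\<integral>x. x \<partial>D) = \<mu>" and "\<mu> > 0"
    and "(\<integral>x. (x - \<mu>) ^ 2 \<partial>D) = \<sigma> ^ 2"
    and "integrable D (\<lambda>x. \<bar>x - \<mu>\<bar> ^ 4)"
  shows "(\<lambda>p. nu2 (M p) p (w p) - ((\<integral>x. (x / \<mu> - 1) ^ 2 \<partial>D) + 1 / real p * h1 D \<mu> \<sigma>))
           \<in> o(\<lambda>p. 1 / real p) \<and>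
         (\<lambda>p. nu12 (M p) p (w p) - ((\<integral>x. (x / \<mu> - 1) ^ 2 \<partial>D) ^ 2 + 1 / real p * h2 D \<mu> \<sigma>))
           \<in> o(\<lambda>p. 1 / real p) \<and>
         (\<lambda>p. nu4 (M p) p (w p) - (\<integral>x. (x / \<mu> - 1) ^ 4 \<partial>D)) \<in> o(\<lambda>_. 1)"
proof -
  note prob = assms(1) and ind = assms(2) and law = assms(3) and pos = assms(4)
    and mean = assms(5) and mu = assms(6) and var = assms(7) and fourth = assms(8)
  have meas: "w p j \<in> borel_measurable (M p)" if "j \<in> {1..p}" for p j
  proof -
    have p: "p \<ge> 1" using that by simp
    interpret prob_space "M p" by (rule prob[OF p])
    show ?thesis using ind[OF p] that unfolding indep_vars_def by blast
  qed
  have D: "D = distr (M 1) borel (w 1 1)" using law[of 1 1] by simp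
  interpret D: prob_space D
    unfolding D by (rule prob_space.prob_space_distr) (use prob meas in auto)
  have [measurable_cong, simp]: "sets D = sets borel" by (simp add: D)
  define m where "m k = (\<integral>x. (x / \<mu> - 1) ^ k \<partial>D)" for k :: nat
  \<comment> \<open>Lower moments come from the fourth:
    \<open>\<bar>y\<bar> ^ k \<le> 1 + \<bar>y\<bar> ^ 4\<close>, and the constant 1 is integrable
    under a probability measure.\<close>
  have int: "integrable D (\<lambda>x. (x / \<mu> - 1) ^ k)" if "k \<le> 4" for k
  proof (rule Bochner_Integration.integrable_bound)
    show "integrable D (\<lambda>x. 1 + \<bar>x - \<mu>\<bar> ^ 4 / \<mu> ^ 4)" using fourth by simp
    have le: "\<bar>y\<bar> ^ k \<le> 1 + \<bar>y\<bar> ^ 4" for y :: real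
    proof (cases "\<bar>y\<bar> \<le> 1")
      case True
      then have "\<bar>y\<bar> ^ k \<le> 1" by (intro power_le_one) auto
      moreover have "0 \<le> \<bar>y\<bar> ^ 4" by simp
      ultimately show ?thesis by linarith
    next
      case False
      then have "\<bar>y\<bar> ^ k \<le> \<bar>y\<bar> ^ 4" using that by (intro power_increasing) auto
      then show ?thesis by simp
    qed
    have "norm ((x / \<mu> - 1) ^ k) \<le> norm (1 + \<bar>x - \<mu>\<bar> ^ 4 / \<mu> ^ 4)" for x
    proof -
      have "\<bar>x / \<mu> - 1\<bar> = \<bar>x - \<mu>\<bar> / \<mu>" using mu by (simp add: abs_div_pos diff_divide_distrib)
      then show ?thesis using le[of "x / \<mu> - 1"] by (simp add: power_abs power_divide)
    qed
    then show "AE x in D. norm ((x / \<mu> - 1) ^ k) \<le> norm (1 + \<bar>x - \<mu>\<bar> ^ 4 / \<mu> ^ 4)" by simp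
  qed measurable
  have hbi: "has_bochner_integral D (\<lambda>x. (x / \<mu> - 1) ^ k) (m k)" if "k \<le> 4" for k
    using int[OF that] by (simp add: m_def has_bochner_integral_iff)
  have int_id: "integrable D (\<lambda>x. x)"
  proof -
    have "integrable D (\<lambda>x. \<mu> * (x / \<mu> - 1) ^ 1 + \<mu>)" using int[of 1] by simp
    then show ?thesis using mu by (simp add: field_simps)
  qed
  have m1: "m 1 = 0"
    unfolding m_def using int_id mean mu by (simp add: D.prob_space)
  have s: "\<sigma>\<^sup>2 / \<mu>\<^sup>2 = m 2"
  proof -
    have "m 2 = (\<integral>x. (x - \<mu>)\<^sup>2 / \<mu>\<^sup>2 \<partial>D)"
      unfolding m_def using mu by (intro Bochner_Integration.integral_cong) (auto simp: field_simps power2_eq_square)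
    then show ?thesis using var by simp
  qed
  \<comment> \<open>Binomial expansion of \<open>((y - 1) + 1) ^ 3\<close> with
    \<open>y = x / \<mu>\<close>. This substitution turns \<open>h1\<close> and \<open>h2\<close>
    into the 1/p coefficients of \<open>taylor2_moment\<close> and
    \<open>taylor12_moment\<close>.\<close>
  have M3: "(\<integral>x. x ^ 3 \<partial>D) / \<mu> ^ 3 = m 3 + 3 * m 2 + 1"
  proof -
    have "has_bochner_integral D (\<lambda>x. (x / \<mu> - 1) ^ 3 + 3 * (x / \<mu> - 1) ^ 2 + 3 * (x / \<mu> - 1) ^ 1 + (x / \<mu> - 1) ^ 0)
        (m 3 + 3 * m 2 + 3 * m 1 + m 0)"
      by (intro has_bochner_integral_add has_bochner_integral_mult_right hbi) auto
    also have "(\<lambda>x. (x / \<mu> - 1) ^ 3 + 3 * (x / \<mu> - 1) ^ 2 + 3 * (x / \<mu> - 1) ^ 1 + (x / \<mu> - 1) ^ 0)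
        = (\<lambda>x. x ^ 3 / \<mu> ^ 3)"
    proof
      fix x
      have "(y - 1) ^ 3 + 3 * (y - 1) ^ 2 + 3 * (y - 1) ^ 1 + (y - 1) ^ 0 = y ^ 3" for y :: real
        by (simp add: power2_eq_square power3_eq_cube algebra_simps)
      then show "(x / \<mu> - 1) ^ 3 + 3 * (x / \<mu> - 1) ^ 2 + 3 * (x / \<mu> - 1) ^ 1 + (x / \<mu> - 1) ^ 0 = x ^ 3 / \<mu> ^ 3"
        by (simp only: power_divide)
    qed
    finally show ?thesis
      using m1 by (simp add: has_bochner_integral_iff m_def D.prob_space)
  qed
  have h1: "h1 D \<mu> \<sigma> = 3 * (m 2)\<^sup>2 - m 2 - 2 * m 3"
    unfolding h1_def s M3 by simp
  have h2: "h2 D \<mu> \<sigma> = 10 * m 2 ^ 3 - 2 * (m 2)\<^sup>2 - 8 * m 3 * m 2"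
    unfolding h2_def s M3 by (simp add: algebra_simps power2_eq_square power3_eq_cube)
  have m2: "0 \<le> m 2" unfolding m_def by (intro integral_nonneg_AE) simp
  define X where "X p j \<omega> = w p j \<omega> / \<mu> - 1" for p j \<omega>
  have iid: "iid_moments (M p) (X p) p m" if p: "2 \<le> p" for p
  proof -
    interpret prob_space "M p" using prob p by simp
    show ?thesis
    proof
      show "indep_vars (\<lambda>_. borel) (X p) {1..p}"
        unfolding X_def[abs_def]
        by (rule indep_vars_compose2[where Y = "\<lambda>_ x. x / \<mu> - 1", OF ind]) (use p in auto)
      show "has_bochner_integral (M p) (\<lambda>\<omega>. X p j \<omega> ^ k) (m k)" if j: "j \<in> {1..p}" and "k \<le> 4" for j k
      proof -
        have "has_bochner_integral (distr (M p) borel (w p j)) (\<lambda>x. (x / \<mu> - 1) ^ k) (m k)"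
          unfolding law[OF j] using hbi that by simp
        then show ?thesis
          unfolding X_def has_bochner_integral_iff using meas[OF j]
          by (simp add: integrable_distr_eq integral_distr)
      qed
      show "AE \<omega> in M p. X p j \<omega> > -1" if "j \<in> {1..p}" for j
        using pos[OF that] by eventually_elim (use mu in \<open>simp add: X_def\<close>)
    qed (use m1 p in simp_all)
  qed
  define rel_dev where "rel_dev p = iid_moments.rel_dev (X p) p" for p
  have ratio: "w p j \<omega> / w_mean p (w p) \<omega> - 1 = rel_dev p j \<omega>" if p: "2 \<le> p" for p j \<omega>
  proof -
    interpret loc: iid_moments "M p" "X p" p m by (rule iid[OF p])
    have "(\<Sum>j=1..p. w p j \<omega>) = (\<Sum>j=1..p. \<mu> * (1 + X p j \<omega>))"
      using mu by (simp add: X_def)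
    also have "\<dots> = \<mu> * (real p * (1 + loc.\<epsilon> \<omega>))"
      using p by (simp add: loc.\<epsilon>_eq_mean sum.distrib algebra_simps flip: sum_distrib_left)
    finally have "w_mean p (w p) \<omega> = \<mu> * (1 + loc.\<epsilon> \<omega>)" using p by (simp add: w_mean_def)
    moreover have "w p j \<omega> = \<mu> * (1 + X p j \<omega>)" using mu by (simp add: X_def)
    ultimately show ?thesis
      unfolding local.rel_dev_def iid_moments.rel_dev_def[OF iid[OF p]] using mu by simp
  qed
  define d where "d = 1 / (8 * (1 + m 2))"
  have d: "d > 0" using m2 by (simp add: d_def)
  \<comment> \<open>The rate depends on \<open>m\<close> alone; the instance at p = 2 merely gives
    access to its defining equation.\<close>
  have rate: "iid_moments.chernoff_rate m = exp (- d)"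
    using iid_moments.chernoff_rate_def[OF iid[of 2]] by (simp add: d_def)
  show ?thesis
  proof (intro conjI)
    show "(\<lambda>p. nu2 (M p) p (w p) - ((\<integral>x. (x / \<mu> - 1) ^ 2 \<partial>D) + 1 / real p * h1 D \<mu> \<sigma>))
        \<in> o(\<lambda>p. 1 / real p)"
    proof (rule smallo_inverse_of_bound[OF _ d])
      fix p :: nat assume p: "2 \<le> p"
      show "\<bar>nu2 (M p) p (w p) - ((\<integral>x. (x / \<mu> - 1) ^ 2 \<partial>D) + 1 / real p * h1 D \<mu> \<sigma>)\<bar>
        \<le> (2560 * iid_moments.remainder_const m) / (real p * sqrt (real p))
          + \<bar>iid_moments.eps2_coeff m 0 0 + 4 * iid_moments.eps2_coeff m 1 0 + 3 * iid_moments.eps2_coeff m 2 0\<bar> / (real p)\<^sup>2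
          + 14 * real p ^ 4 * exp (- d) ^ p"
        using iid_moments.square_ratio_expansion[OF iid[OF p]]
        unfolding nu2_def ratio[OF p] h1 rate rel_dev_def m_def[symmetric] by simp
    qed
    show "(\<lambda>p. nu12 (M p) p (w p) - ((\<integral>x. (x / \<mu> - 1) ^ 2 \<partial>D) ^ 2 + 1 / real p * h2 D \<mu> \<sigma>))
        \<in> o(\<lambda>p. 1 / real p)"
    proof (rule smallo_inverse_of_bound[OF _ d])
      fix p :: nat assume p: "2 \<le> p"
      show "\<bar>nu12 (M p) p (w p) - ((\<integral>x. (x / \<mu> - 1) ^ 2 \<partial>D) ^ 2 + 1 / real p * h2 D \<mu> \<sigma>)\<bar>
        \<le> (64000 * iid_moments.remainder_const m) / (real p * sqrt (real p))
          + \<bar>10 * iid_moments.eps2_coeff m 2 2 + 8 * iid_moments.eps2_coeff m 2 1 + 8 * iid_moments.eps2_coeff m 1 2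
             + iid_moments.eps2_coeff m 2 0 + iid_moments.eps2_coeff m 0 2 + 4 * iid_moments.eps2_coeff m 1 1\<bar> / (real p)\<^sup>2
          + 42 * real p ^ 4 * exp (- d) ^ p"
        using iid_moments.square_product_ratio_expansion[OF iid[OF p]]
        unfolding nu12_def ratio[OF p] h2 rate rel_dev_def m_def[symmetric] by simp
    qed
    \<comment> \<open>The truncated term of \<open>fourth_power_ratio_bound\<close> is moved to the
      common law \<open>D\<close>. There it tends to 0 pointwise under the integrable envelope
      \<open>1 + (x / \<mu> - 1) ^ 4\<close>, although the spaces \<open>M p\<close> vary.\<close>
    define g where "g p x = (1 + (x / \<mu> - 1) ^ 4) * min 1 (\<bar>x / \<mu> - 1\<bar> / real p)" for p x
    define \<kappa> where "\<kappa> p = (\<integral>x. g p x \<partial>D)" for p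
    have g_bound: "norm (g p x) \<le> 1 + (x / \<mu> - 1) ^ 4" for p x
    proof -
      have "(1 + (x / \<mu> - 1) ^ 4) * min 1 (\<bar>x / \<mu> - 1\<bar> / real p) \<le> (1 + (x / \<mu> - 1) ^ 4) * 1"
        by (intro mult_left_mono) auto
      then show ?thesis by (simp add: g_def abs_mult)
    qed
    have dom: "integrable D (\<lambda>x. 1 + (x / \<mu> - 1) ^ 4)" using int[of 4] by simp
    have g_meas [measurable]: "g p \<in> borel_measurable borel" for p
      unfolding g_def[abs_def] by measurable
    have g_int: "integrable D (g p)" for p
      by (rule Bochner_Integration.integrable_bound[OF dom])
        (use g_bound order_trans[OF g_bound abs_ge_self] in auto)
    have \<kappa>0: "\<kappa> \<longlonglongrightarrow> (\<integral>x. 0 \<partial>D)"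
      unfolding \<kappa>_def[abs_def]
    proof (rule integral_dominated_convergence[OF _ _ dom])
      have "(\<lambda>p. g p x) \<longlonglongrightarrow> (1 + (x / \<mu> - 1) ^ 4) * min 1 0" for x
        unfolding g_def by (intro tendsto_intros lim_const_over_n)
      then show "AE x in D. (\<lambda>p. g p x) \<longlonglongrightarrow> 0" by simp
      show "AE x in D. norm (g p x) \<le> 1 + (x / \<mu> - 1) ^ 4" for p using g_bound by simp
    qed measurable
    define a where "a = (1 + m 4) * (1 + m 2)"
    define e where "e p = 640 * (\<kappa> p + a / sqrt (real p) + a / real p) + 2 * (real p ^ 4 * exp (- d * real p))" for p
    have "(\<lambda>p. a / sqrt (real p)) \<longlonglongrightarrow> 0" "(\<lambda>p. a / real p) \<longlonglongrightarrow> 0"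
      "(\<lambda>p. real p ^ 4 * exp (- d * real p)) \<longlonglongrightarrow> 0"
      using d by real_asymp+
    then have "(\<lambda>p. 640 * (\<kappa> p + a / sqrt (real p) + a / real p) + 2 * (real p ^ 4 * exp (- d * real p)))
        \<longlonglongrightarrow> 640 * (0 + 0 + 0) + 2 * 0"
      using \<kappa>0 by (intro tendsto_intros) simp_all
    then have e0: "e \<longlonglongrightarrow> 0" by (simp add: e_def[abs_def])
    have "\<bar>nu4 (M p) p (w p) - m 4\<bar> \<le> e p" if p: "2 \<le> p" for p
    proof -
      have j: "1 \<in> {1..p}" using p by simp
      have "has_bochner_integral (distr (M p) borel (w p 1)) (g p) (\<kappa> p)"
        unfolding law[OF j] \<kappa>_def using g_int by (simp add: has_bochner_integral_iff)
      then have "has_bochner_integral (M p) (\<lambda>\<omega>. g p (w p 1 \<omega>)) (\<kappa> p)"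
        unfolding has_bochner_integral_iff using meas[OF j]
        by (simp add: integrable_distr_eq integral_distr)
      then have "has_bochner_integral (M p) (\<lambda>\<omega>. (1 + X p 1 \<omega> ^ 4) * min 1 (\<bar>X p 1 \<omega>\<bar> / real p)) (\<kappa> p)"
        by (simp only: g_def X_def)
      from iid_moments.fourth_power_ratio_bound[OF iid[OF p] this]
      have "\<bar>nu4 (M p) p (w p) - m 4\<bar> \<le> 640 * (\<kappa> p + a / sqrt (real p) + a / real p) + 2 * real p ^ 4 * exp (- d) ^ p"
        unfolding nu4_def ratio[OF p] rate rel_dev_def a_def .
      also have "exp (- d) ^ p = exp (- d * real p)"
        by (simp add: exp_of_nat_mult[symmetric] mult.commute)
      finally show ?thesis by (simp add: e_def)
    qed
    then have "eventually (\<lambda>p. norm (nu4 (M p) p (w p) - m 4) \<le> e p) sequentially"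
      unfolding eventually_sequentially by auto
    then have "(\<lambda>p. nu4 (M p) p (w p) - m 4) \<longlonglongrightarrow> 0"
      using e0 by (rule Lim_null_comparison)
    then show "(\<lambda>p. nu4 (M p) p (w p) - (\<integral>x. (x / \<mu> - 1) ^ 4 \<partial>D)) \<in> o(\<lambda>_. 1)"
      by (intro smalloI_tendsto) (simp_all add: m_def)
  qed
qed

end
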